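(* Let $q$ be a prime power and $n\ge 1$ an integer. Let $X_0=0$ and $X_i=\operatorname{rank}(C_i)-\operatorname{rank}(C_{i-1})$ for $i\ge 1$ (with $\operatorname{rank}(C_0)=0$), where $C_1,C_2,\dots$ are the random block lower bidiagonal matrices over $\mathbb{F}_q$ described in the context. Then $(X_i)_{i\ge 0}$ is a time homogeneous, irreducible, aperiodic, reversible Markov chain on the state space $\{0,1,\dots,n\}$ with transition matrix $$P_n(d,r)=\mathbf{1}(d+r\le n)\,q^{-(n-d-r)(n-r)}\,\frac{(q^{-(n-d)};q)_r\,(q^{-n};q)_r}{(q^{-r};q)_r},\qquad 0\le d,r\le n.$$ Moreover, the stationary measure $\pi_n$ of this Markov chain is given by $$\pi_n(h)=\frac{1}{\mathcal{Z}_n}\,q^{h(n-h)}\frac{(q^{-n};q)_h^2}{(q^{-h};q)_h},\qquad \mathcal{Z}_n=\sum_{h=0}^n q^{h(n-h)}\frac{(q^{-n};q)_h^2}{(q^{-h};q)_h}.$$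
   Context: $\mathbb{F}_q$ is the field with $q$ elements. The $q$-Pochhammer symbol is $(a;q)_r=\prod_{i=0}^{r-1}(1-aq^i)$. Let $A=(A_{i,j})_{i,j=1}^\infty$ be a random infinite block matrix over $\mathbb{F}_q$ whose blocks are $n\times n$ matrices, such that $A_{i,j}=0$ whenever $j\notin\{i,i-1\}$, while the blocks $A_{i,i}$ ($i\ge 1$) and $A_{i,i-1}$ ($i\ge 2$) are independent and uniformly distributed over all $n\times n$ matrices over $\mathbb{F}_q$. For $k\ge 1$, $C_{2k-1}$ is the submatrix of $A$ formed by the first $kn$ rows and first $kn$ columns, and $C_{2k}$ is the submatrix formed by the first $(k+1)n$ rows and first $kn$ columns. *)

theory Defs
  imports "HOL-Probability.Probability" "Jordan_Normal_Form.DL_Rank"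
begin

section \<open>Finite-state Markov chains\<close>

text \<open>A chain is given by a state space \<open>S\<close> and a transition matrix \<open>P\<close>, of which only
  the values on \<open>S\<close> matter.\<close>

definition stochastic_on :: "'s set \<Rightarrow> ('s \<Rightarrow> 's \<Rightarrow> real) \<Rightarrow> bool" where
  "stochastic_on S P \<longleftrightarrow> (\<forall>x\<in>S. (\<forall>y\<in>S. 0 \<le> P x y) \<and> (\<Sum>y\<in>S. P x y) = 1)"

definition markov_chain ::
  "'w measure \<Rightarrow> (nat \<Rightarrow> 'w \<Rightarrow> 's) \<Rightarrow> 's set \<Rightarrow> ('s \<Rightarrow> 's \<Rightarrow> real) \<Rightarrow> bool" where
  "markov_chain M X S P \<longleftrightarrow>
     prob_space M \<and> finite S \<and> stochastic_on S P \<and>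
     (\<forall>t. X t \<in> measurable M (count_space S)) \<and>
     (\<forall>t x. (\<forall>i\<le>Suc t. x i \<in> S) \<longrightarrow>
        \<P>(\<omega> in M. \<forall>i\<le>t. X i \<omega> = x i) > 0 \<longrightarrow>
        \<P>(\<omega> in M. X (Suc t) \<omega> = x (Suc t) \<bar> \<forall>i\<le>t. X i \<omega> = x i) = P (x t) (x (Suc t)))"

primrec step_prob :: "'s set \<Rightarrow> ('s \<Rightarrow> 's \<Rightarrow> real) \<Rightarrow> nat \<Rightarrow> 's \<Rightarrow> 's \<Rightarrow> real" where
  "step_prob S P 0 x y = (if x = y then 1 else 0)"
| "step_prob S P (Suc t) x y = (\<Sum>z\<in>S. P x z * step_prob S P t z y)"

definition irreducible_chain :: "'s set \<Rightarrow> ('s \<Rightarrow> 's \<Rightarrow> real) \<Rightarrow> bool" where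
  "irreducible_chain S P \<longleftrightarrow> (\<forall>x\<in>S. \<forall>y\<in>S. \<exists>t. step_prob S P t x y > 0)"

definition aperiodic_chain :: "'s set \<Rightarrow> ('s \<Rightarrow> 's \<Rightarrow> real) \<Rightarrow> bool" where
  "aperiodic_chain S P \<longleftrightarrow> (\<forall>x\<in>S. Gcd {t. 1 \<le> t \<and> step_prob S P t x x > 0} = 1)"

definition distribution_on :: "'s set \<Rightarrow> ('s \<Rightarrow> real) \<Rightarrow> bool" where
  "distribution_on S \<mu> \<longleftrightarrow> (\<forall>x\<in>S. 0 \<le> \<mu> x) \<and> (\<Sum>x\<in>S. \<mu> x) = 1"

definition stationary_measure :: "'s set \<Rightarrow> ('s \<Rightarrow> 's \<Rightarrow> real) \<Rightarrow> ('s \<Rightarrow> real) \<Rightarrow> bool" where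
  "stationary_measure S P \<mu> \<longleftrightarrow>
     distribution_on S \<mu> \<and> (\<forall>y\<in>S. (\<Sum>x\<in>S. \<mu> x * P x y) = \<mu> y)"

definition reversible_chain :: "'s set \<Rightarrow> ('s \<Rightarrow> 's \<Rightarrow> real) \<Rightarrow> bool" where
  "reversible_chain S P \<longleftrightarrow>
     (\<exists>\<mu>. distribution_on S \<mu> \<and> (\<forall>x\<in>S. \<forall>y\<in>S. \<mu> x * P x y = \<mu> y * P y x))"


section \<open>Random block lower bidiagonal matrices\<close>

text \<open>Blocks are indexed from 1, scalar rows and columns from 0.\<close>

definition bidiagonal_positions :: "(nat \<times> nat) set" where
  "bidiagonal_positions = {(i, j). 1 \<le> i \<and> i = j} \<union> {(i, j). 2 \<le> i \<and> j = i - 1}"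

definition uniform_block_bidiagonal ::
  "'w measure \<Rightarrow> nat \<Rightarrow> (nat \<Rightarrow> nat \<Rightarrow> 'w \<Rightarrow> 'a::{field,finite} mat) \<Rightarrow> bool" where
  "uniform_block_bidiagonal M n A \<longleftrightarrow>
     prob_space M \<and>
     (\<forall>i\<ge>1. \<forall>j\<ge>1. (i, j) \<notin> bidiagonal_positions \<longrightarrow> (\<forall>\<omega>\<in>space M. A i j \<omega> = 0\<^sub>m n n)) \<and>
     prob_space.indep_vars M (\<lambda>_. count_space (carrier_mat n n)) (\<lambda>(i, j). A i j)
       bidiagonal_positions \<and>
     (\<forall>(i, j)\<in>bidiagonal_positions.
        distr M (count_space (carrier_mat n n)) (A i j) = uniform_count_measure (carrier_mat n n))"

definition block_entry :: "nat \<Rightarrow> (nat \<Rightarrow> nat \<Rightarrow> 'a mat) \<Rightarrow> nat \<Rightarrow> nat \<Rightarrow> 'a" where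
  "block_entry n B i j = B (i div n + 1) (j div n + 1) $$ (i mod n, j mod n)"

definition corner :: "nat \<Rightarrow> (nat \<Rightarrow> nat \<Rightarrow> 'a mat) \<Rightarrow> nat \<Rightarrow> nat \<Rightarrow> 'a mat" where
  "corner n B nr nc = mat nr nc (\<lambda>(i, j). block_entry n B i j)"

text \<open>With \<open>k = (m + 1) div 2\<close> we have \<open>m = 2 * k - 1\<close> for odd \<open>m\<close> and \<open>m = 2 * k\<close> for even \<open>m\<close>.\<close>

definition C_mat :: "nat \<Rightarrow> (nat \<Rightarrow> nat \<Rightarrow> 'a mat) \<Rightarrow> nat \<Rightarrow> 'a mat" where
  "C_mat n B m = (let k = (m + 1) div 2 in
     if odd m then corner n B (k * n) (k * n) else corner n B ((k + 1) * n) (k * n))"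

definition C_rank :: "nat \<Rightarrow> (nat \<Rightarrow> nat \<Rightarrow> 'a::field mat) \<Rightarrow> nat \<Rightarrow> nat" where
  "C_rank n B m =
     (if m = 0 then 0 else vec_space.rank (dim_row (C_mat n B m)) (C_mat n B m))"

text \<open>The increments are integers, so that no truncated subtraction is involved.\<close>

definition rank_increment ::
  "nat \<Rightarrow> (nat \<Rightarrow> nat \<Rightarrow> 'w \<Rightarrow> 'a::field mat) \<Rightarrow> nat \<Rightarrow> 'w \<Rightarrow> int" where
  "rank_increment n A i \<omega> =
     (if i = 0 then 0
      else int (C_rank n (\<lambda>k l. A k l \<omega>) i) - int (C_rank n (\<lambda>k l. A k l \<omega>) (i - 1)))"


section \<open>Transition matrix and stationary measure\<close>

definition q_pochhammer :: "real \<Rightarrow> real \<Rightarrow> nat \<Rightarrow> real" where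
  "q_pochhammer a q r = (\<Prod>i<r. 1 - a * q ^ i)"

text \<open>States are integers in \<open>{0..int n}\<close>; \<open>nat\<close> only converts them to the length of a product.\<close>

definition rank_transition :: "real \<Rightarrow> nat \<Rightarrow> int \<Rightarrow> int \<Rightarrow> real" where
  "rank_transition q n d r =
     (if d + r \<le> int n
      then q powi (- ((int n - d - r) * (int n - r)))
           * (q_pochhammer (q powi (- (int n - d))) q (nat r)
              * q_pochhammer (q powi (- int n)) q (nat r)
              / q_pochhammer (q powi (- r)) q (nat r))
      else 0)"

definition rank_weight :: "real \<Rightarrow> nat \<Rightarrow> int \<Rightarrow> real" where
  "rank_weight q n h =
     q powi (h * (int n - h))
     * ((q_pochhammer (q powi (- int n)) q (nat h))\<^sup>2
        / q_pochhammer (q powi (- h)) q (nat h))"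

definition rank_stationary :: "real \<Rightarrow> nat \<Rightarrow> int \<Rightarrow> real" where
  "rank_stationary q n h = 1 / (\<Sum>k\<in>{0..int n}. rank_weight q n k) * rank_weight q n h"

end

theory Submission
  imports Defs "Berlekamp_Zassenhaus.Berlekamp_Type_Based"
begin

text \<open>
The matrix \<open>C\<^bsub>t+1\<^esub>\<close> arises from \<open>C\<^bsub>t\<^esub>\<close> by attaching one fresh uniform block \<open>D\<close>, as \<open>n\<close> new
columns or as \<open>n\<close> new rows, which vanish outside \<open>D\<close>. Say that columns are attached. Then
\<open>C\<^bsub>t\<^esub>\<close> consists of \<open>C\<^bsub>t-1\<^esub>\<close> and \<open>n\<close> further rows below it. Let \<open>W\<close> be the column space of \<open>C\<^bsub>t\<^esub>\<close>
and \<open>E\<close> the space of the vectors supported on the last \<open>n\<close> coordinates. The new columns lie in \<open>E\<close>,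
so they raise the rank by the dimension that they span modulo \<open>W \<inter> E\<close>. The projection that
forgets the last \<open>n\<close> coordinates has kernel \<open>W \<inter> E\<close> on \<open>W\<close> and maps \<open>W\<close> onto the column space of
\<open>C\<^bsub>t-1\<^esub>\<close>; therefore \<open>W \<inter> E\<close> has dimension \<open>rank C\<^bsub>t\<^esub> - rank C\<^bsub>t-1\<^esub> = X\<^bsub>t\<^esub>\<close> (\<open>append_rows_rank\<close>).
So, given the past, \<open>X\<^bsub>t+1\<^esub>\<close> is the rank of a uniform \<open>(n - X\<^bsub>t\<^esub>) \<times> n\<close> matrix, and the number of
blocks that realise an increment \<open>r\<close> depends on \<open>X\<^bsub>t\<^esub>\<close> only (\<open>card_spanning_extensions\<close>,
\<open>card_block_completions\<close>, \<open>card_next_block_increment\<close>). Attaching rows is the same situation after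
transposition, because row rank equals column rank (\<open>rank_transpose\<close>). As the blocks are independent
and uniform, counting block sequences gives the Markov property (\<open>markov_chain_rank_increment\<close>), and
the transition probabilities are the proportions of matrices of a given rank
(\<open>rank_transition_eq_rank_count\<close>).

Because the field is finite, the dimension of a space is read off from its cardinality, and the linear
algebra is done by counting.

The weights satisfy the detailed balance equations (\<open>rank_weight_detailed_balance\<close>), which gives
reversibility and stationarity. All transitions \<open>d \<rightarrow> 0\<close> and \<open>0 \<rightarrow> r\<close> have positive probability;
passing through the state 0 shows irreducibility and aperiodicity, and a maximum principle shows that
the stationary distribution is unique (\<open>stationary_unique_via_hub\<close>).
\<close>

section \<open>Counting matrices of given rank\<close>

text \<open>The number of \<open>m \<times> k\<close> matrices of rank \<open>r\<close> over a field with \<open>q\<close> elements. The product also has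
the right value outside the range \<open>r \<le> min m k\<close>: a factor with \<open>i = m\<close> or \<open>i = k\<close> makes it zero.\<close>

definition rank_count :: "real \<Rightarrow> nat \<Rightarrow> nat \<Rightarrow> nat \<Rightarrow> real" where
  "rank_count q m k r = (\<Prod>i<r. (q ^ m - q ^ i) * (q ^ k - q ^ i) / (q ^ r - q ^ i))"

lemma rank_count_0 [simp]: "rank_count q m k 0 = 1"
  by (simp add: rank_count_def)

lemma rank_count_eq_0:
  assumes "m < r \<or> k < r"
  shows "rank_count q m k r = 0"
  using assms unfolding rank_count_def by (auto intro!: prod_zero)

lemma rank_count_pos:
  assumes "1 < q" "r \<le> m" "r \<le> k"
  shows "0 < rank_count q m k r"
  unfolding rank_count_def using assms by (auto intro!: prod_pos divide_pos_pos mult_pos_pos)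

lemma prod_power_diff_shift:
  fixes q :: "'a::comm_ring_1"
  shows "(\<Prod>i<Suc r. q ^ Suc m - q ^ i) = (q ^ Suc m - 1) * (q ^ r * (\<Prod>i<r. q ^ m - q ^ i))"
proof -
  have "(\<Prod>i<Suc r. q ^ Suc m - q ^ i) = (q ^ Suc m - 1) * (\<Prod>i<r. q * (q ^ m - q ^ i))"
    unfolding prod.lessThan_Suc_shift by (simp add: algebra_simps)
  then show ?thesis by (simp only: prod.distrib prod_constant card_lessThan)
qed

text \<open>The recursion obtained by choosing the first column: either it is zero, or it is one of the
\<open>q ^ Suc m - 1\<close> other vectors; then the remaining \<open>k\<close> columns have rank \<open>r\<close> modulo it, which happens
for \<open>rank_count q m k r\<close> classes of columns, each class having \<open>q ^ k\<close> members.\<close>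

lemma rank_count_Suc_Suc:
  assumes "1 < q"
  shows "rank_count q (Suc m) (Suc k) (Suc r) =
    rank_count q (Suc m) k (Suc r) + (q ^ Suc m - 1) * q ^ k * rank_count q m k r"
proof -
  define p where "p m r = (\<Prod>i<r. q ^ m - q ^ i)" for m r
  have p_shift: "p (Suc m) (Suc r) = (q ^ Suc m - 1) * (q ^ r * p m r)" for m r
    unfolding p_def by (rule prod_power_diff_shift)
  have p_Suc: "p m (Suc r) = p m r * (q ^ m - q ^ r)" for m r
    unfolding p_def by simp
  have count: "rank_count q m k r = p m r * p k r / p r r" for m k r
    unfolding rank_count_def p_def by (simp add: prod_dividef prod.distrib)
  have nonzero: "q ^ r \<noteq> 0" "q ^ Suc r - 1 \<noteq> 0"
    using assms one_less_power[of q "Suc r"] by auto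
  have "p r r > 0"
    unfolding p_def using assms by (auto intro!: prod_pos)
  then have p_nonzero: "p r r \<noteq> 0" by simp
  have step: "u * (a * x) * (e * (a * y)) / (v * (a * z)) =
      u * (a * x) * (y * (e * a - g * v)) / (v * (a * z)) + u * g * (x * y / z)"
    if "a \<noteq> 0" "v \<noteq> 0" "z \<noteq> 0" for a e g u v x y z :: real
    using that by (simp add: field_simps)
  have pascal: "q ^ k - q ^ r = (q ^ Suc k - 1) * q ^ r - q ^ k * (q ^ Suc r - 1)"
    by (simp add: algebra_simps)
  show ?thesis
    unfolding count p_shift p_Suc[of k r] pascal by (intro step nonzero p_nonzero)
qed

text \<open>Every \<open>m \<times> k\<close> matrix has some rank. This is what makes the rows of the transition matrix sum
to one.\<close>

lemma sum_rank_count: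
  assumes "1 < q"
  shows "(\<Sum>r\<le>k. rank_count q m k r) = q ^ (m * k)"
proof (induction k arbitrary: m)
  case (Suc k)
  show ?case
  proof (cases m)
    case 0
    have "(\<Sum>r\<le>Suc k. rank_count q m (Suc k) r) = (\<Sum>r\<le>Suc k. if r = 0 then 1 else 0)"
      unfolding 0 by (intro sum.cong) (auto simp: rank_count_eq_0)
    then show ?thesis
      by (simp add: 0)
  next
    case (Suc m')
    have "(\<Sum>r\<le>Suc k. rank_count q m (Suc k) r) =
      1 + (\<Sum>r\<le>k. rank_count q m k (Suc r)) + (q ^ m - 1) * q ^ k * (\<Sum>r\<le>k. rank_count q m' k r)"
      unfolding sum.atMost_Suc_shift Suc rank_count_Suc_Suc[OF assms]
      by (simp add: sum.distrib sum_distrib_left mult.assoc)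
    also have "1 + (\<Sum>r\<le>k. rank_count q m k (Suc r)) = (\<Sum>r\<le>Suc k. rank_count q m k r)"
      unfolding sum.atMost_Suc_shift by simp
    also have "\<dots> = q ^ (m * k)"
      using Suc.IH[of m] by (simp add: rank_count_eq_0)
    finally show ?thesis
      unfolding Suc.IH by (simp add: Suc algebra_simps power_add)
  qed
qed simp

section \<open>The transition matrix and the stationary weights\<close>

lemma q_pochhammer_inverse_power:
  assumes "q \<noteq> 0"
  shows "q_pochhammer (q powi (- int m)) q r = (\<Prod>i<r. q ^ m - q ^ i) / q ^ (m * r)"
proof -
  have "q_pochhammer (q powi (- int m)) q r = (\<Prod>i<r. (q ^ m - q ^ i) / q ^ m)"
    unfolding q_pochhammer_def using assms
    by (intro prod.cong) (auto simp: power_int_minus field_simps)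
  then show ?thesis by (simp add: prod_dividef power_mult)
qed

text \<open>The combinatorial meaning of the transition matrix: from \<open>d\<close>, the chain moves to the rank of a
uniformly random \<open>(n - d) \<times> n\<close> matrix.\<close>

lemma rank_transition_eq_rank_count:
  assumes "1 < q" "d \<le> n" "r \<le> n"
  shows "rank_transition q n (int d) (int r) = rank_count q (n - d) n r / q ^ ((n - d) * n)"
proof (cases "d + r \<le> n")
  case True
  define m where "m = n - d"
  have m: "n = m + d" "r \<le> m" "int n - int d = int m" using True by (auto simp: m_def)
  obtain l where l: "m = r + l" using m(2) le_Suc_ex by blast
  have q: "q \<noteq> 0" using assms by simp
  have e: "(int m - int r) * (int n - int r) = int (l * (n - r))"
    using l assms(3) by (simp add: of_nat_diff)
  obtain j where j: "n = r + j" using assms(3) le_Suc_ex by blast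
  \<comment> \<open>The exponent \<open>l * (n - r)\<close> of the transition matrix is exactly what is left of \<open>m * n\<close> after the
powers of \<open>q\<close> have been taken out of the three products.\<close>
  have e2: "m * r + n * r + l * (n - r) = r * r + m * n"
    unfolding l j by (simp add: algebra_simps)
  have "rank_transition q n (int d) (int r) =
      inverse (q ^ (l * (n - r))) *
      ((\<Prod>i<r. q ^ m - q ^ i) / q ^ (m * r) * ((\<Prod>i<r. q ^ n - q ^ i) / q ^ (n * r)) /
        ((\<Prod>i<r. q ^ r - q ^ i) / q ^ (r * r)))"
    unfolding rank_transition_def m(3) nat_int e q_pochhammer_inverse_power[OF q]
    using True by (simp only: power_int_minus power_int_of_nat zle_int[symmetric] of_nat_add if_True)
  also have "\<dots> = (\<Prod>i<r. q ^ m - q ^ i) * (\<Prod>i<r. q ^ n - q ^ i) / (\<Prod>i<r. q ^ r - q ^ i)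
      * (q ^ (r * r) / q ^ (m * r + n * r + l * (n - r)))"
    by (simp only: power_add divide_inverse inverse_mult_distrib inverse_inverse_eq mult_ac)
  also have "\<dots> = rank_count q m n r / q ^ (m * n)"
    unfolding e2 rank_count_def using q by (simp add: power_add prod_dividef prod.distrib)
  finally show ?thesis unfolding m_def .
next
  case False
  then have "rank_count q (n - d) n r = 0" using assms(2) by (intro rank_count_eq_0) arith
  with False show ?thesis by (simp add: rank_transition_def)
qed

lemma rank_transition_pos:
  assumes "1 < q" "0 \<le> d" "0 \<le> r" "d + r \<le> int n"
  shows "0 < rank_transition q n d r"
proof -
  obtain d' r' where "d = int d'" "r = int r'" using assms nonneg_int_cases by metis
  then show ?thesis
    using assms rank_transition_eq_rank_count[of q d' n r'] rank_count_pos[of q r' "n - d'" n] by simp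
qed

lemma stochastic_rank_transition:
  assumes "1 < q"
  shows "stochastic_on {0..int n} (rank_transition q n)"
  unfolding stochastic_on_def
proof (intro ballI conjI)
  fix d r assume "d \<in> {0..int n}" "r \<in> {0..int n}"
  then show "0 \<le> rank_transition q n d r"
    using rank_transition_pos[OF assms, of d r n] by (cases "d + r \<le> int n") (auto simp: rank_transition_def)
next
  fix d assume "d \<in> {0..int n}"
  then obtain d' where d: "d = int d'" "d' \<le> n" by (intro that[of "nat d"]) auto
  have "(\<Sum>r\<in>{0..int n}. rank_transition q n d r) = (\<Sum>r\<le>n. rank_transition q n d (int r))"
    by (rule sum.reindex_bij_witness[of _ int nat]) auto
  also have "\<dots> = (\<Sum>r\<le>n. rank_count q (n - d') n r) / q ^ ((n - d') * n)"
    unfolding d(1) sum_divide_distrib using d by (intro sum.cong) (auto simp: rank_transition_eq_rank_count[OF assms])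
  finally show "(\<Sum>r\<in>{0..int n}. rank_transition q n d r) = 1"
    using assms by (simp add: sum_rank_count)
qed

lemma q_pochhammer_add:
  "q_pochhammer a q (d + r) = q_pochhammer a q d * q_pochhammer (a * q ^ d) q r"
  by (induction r) (simp_all add: q_pochhammer_def power_add mult_ac)

text \<open>Writing \<open>(a)_r\<close> for \<open>q_pochhammer a q r\<close>, one has
\<open>(q^-n)_(d+r) = (q^-n)_d (q^-(n-d))_r\<close>. So the stationary flow from \<open>d\<close> to \<open>r\<close> can be
written as an expression that is visibly symmetric in \<open>d\<close> and \<open>r\<close>.\<close>

lemma rank_weight_detailed_balance:
  assumes "q \<noteq> 0" "0 \<le> d" "0 \<le> r"
  shows "rank_weight q n d * rank_transition q n d r = rank_weight q n r * rank_transition q n r d"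
proof (cases "d + r \<le> int n")
  case True
  have flow: "rank_weight q n d * rank_transition q n d r =
      q powi (2 * int n * (d + r) - int n * int n - (d * d + r * r + d * r)) *
      (q_pochhammer (q powi (- int n)) q (nat (d + r)) *
       q_pochhammer (q powi (- int n)) q (nat d) * q_pochhammer (q powi (- int n)) q (nat r) /
       (q_pochhammer (q powi (- d)) q (nat d) * q_pochhammer (q powi (- r)) q (nat r)))"
    if "0 \<le> d" "0 \<le> r" "d + r \<le> int n" for d r
  proof -
    have a: "q powi (- int n) * q ^ nat d = q powi (- (int n - d))"
      using assms(1) that by (simp add: power_int_diff power_int_minus field_simps flip: power_int_of_nat)
    have b: "q powi (2 * int n * (d + r) - int n * int n - (d * d + r * r + d * r)) =
      q powi (d * (int n - d)) * q powi (- ((int n - d - r) * (int n - r)))"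
      using assms(1) by (subst power_int_add[symmetric]) (auto simp: algebra_simps)
    show ?thesis
      unfolding b nat_add_distrib[OF that(1,2)] q_pochhammer_add a
      using that by (simp add: rank_weight_def rank_transition_def power2_eq_square)
  qed
  show ?thesis
    unfolding flow[OF assms(2,3) True] using True flow[of r d] assms by (simp add: ac_simps)
next
  case False
  then show ?thesis by (simp add: rank_transition_def)
qed

lemma q_pochhammer_inverse_power_pos:
  assumes "1 < q" "r \<le> m"
  shows "0 < q_pochhammer (q powi (- int m)) q r"
  using assms by (auto simp: q_pochhammer_inverse_power intro!: prod_pos divide_pos_pos)

lemma rank_weight_pos:
  assumes "1 < q" "0 \<le> h" "h \<le> int n"
  shows "0 < rank_weight q n h"
proof -
  obtain k where "h = int k" using assms(2) nonneg_int_cases by metis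
  then show ?thesis
    using assms q_pochhammer_inverse_power_pos[of q k n] q_pochhammer_inverse_power_pos[of q k k]
    by (simp add: rank_weight_def)
qed

section \<open>Chains with a hub state\<close>

lemma step_prob_nonneg:
  assumes "stochastic_on S P" "x \<in> S" "y \<in> S"
  shows "0 \<le> step_prob S P t x y"
  using assms(2) 
proof (induction t arbitrary: x)
  case (Suc t)
  then show ?case using assms by (auto simp: stochastic_on_def intro!: sum_nonneg)
qed simp

lemma step_prob_Suc_pos:
  assumes "finite S" "stochastic_on S P" "x \<in> S" "y \<in> S" "z \<in> S" "0 < P x z" "0 < step_prob S P t z y"
  shows "0 < step_prob S P (Suc t) x y"
proof -
  have "0 < P x z * step_prob S P t z y" using assms by simp
  also have "\<dots> \<le> (\<Sum>w\<in>S. P x w * step_prob S P t w y)"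
    using assms step_prob_nonneg[OF assms(2)]
    by (intro member_le_sum) (auto simp: stochastic_on_def)
  finally show ?thesis by simp
qed

text \<open>A state \<open>z\<close> that can be reached from every state in one step, and from which every state can be
reached in one step, forces all the qualitative properties of the chain: any two states are
connected by paths of length 2 and 3 through \<open>z\<close>. For the rank chain, \<open>z = 0\<close>.\<close>

context
  fixes S :: "'s set" and P :: "'s \<Rightarrow> 's \<Rightarrow> real" and z :: 's
  assumes fin: "finite S" and stoch: "stochastic_on S P" and z: "z \<in> S"
    and to_z: "\<And>x. x \<in> S \<Longrightarrow> 0 < P x z" and from_z: "\<And>x. x \<in> S \<Longrightarrow> 0 < P z x"
begin

lemma step_prob_via_hub:
  assumes "x \<in> S" "y \<in> S"
  shows "0 < step_prob S P 2 x y" "0 < step_prob S P 3 x y"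
proof -
  have 1: "0 < step_prob S P (Suc 0) z y"
    using assms z from_z fin stoch by (intro step_prob_Suc_pos[of S P z y y]) auto
  have 2: "0 < step_prob S P (Suc (Suc 0)) w y" if "w \<in> S" for w
    using assms z to_z[OF that] fin stoch 1 that by (intro step_prob_Suc_pos[of S P w y z]) auto
  have 3: "0 < step_prob S P (Suc (Suc (Suc 0))) x y"
    using assms z to_z[OF assms(1)] fin stoch 2[OF z] by (intro step_prob_Suc_pos[of S P x y z]) auto
  show "0 < step_prob S P 2 x y" "0 < step_prob S P 3 x y"
    using 2[OF assms(1)] 3 by (simp_all only: numeral_2_eq_2 numeral_3_eq_3)
qed

lemma irreducible_via_hub: "irreducible_chain S P"
  unfolding irreducible_chain_def using step_prob_via_hub(1) by blast

lemma aperiodic_via_hub: "aperiodic_chain S P"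
  unfolding aperiodic_chain_def
proof
  fix x assume "x \<in> S"
  let ?T = "{t. 1 \<le> t \<and> 0 < step_prob S P t x x}"
  have "2 \<in> ?T" "3 \<in> ?T"
    using step_prob_via_hub[OF \<open>x \<in> S\<close> \<open>x \<in> S\<close>] by auto
  then have "Gcd ?T dvd 3 - 2"
    by (intro dvd_diff_nat Gcd_dvd)
  then show "Gcd ?T = 1" by simp
qed

text \<open>The maximum principle: by reversibility, the density \<open>h = \<mu> / \<pi>\<close> of a stationary \<open>\<mu>\<close> is
harmonic. A harmonic function that is maximal at \<open>x\<close> is maximal at all successors of \<open>x\<close>. So the
maximum spreads from wherever it is attained to \<open>z\<close>, and from there to all states; \<open>h\<close> is constant.\<close>

lemma stationary_unique_via_hub:
  assumes pos: "\<And>x. x \<in> S \<Longrightarrow> 0 < \<pi> x" and dist: "distribution_on S \<pi>"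
    and balance: "\<And>x y. x \<in> S \<Longrightarrow> y \<in> S \<Longrightarrow> \<pi> x * P x y = \<pi> y * P y x"
    and \<mu>: "stationary_measure S P \<mu>" and "x \<in> S"
  shows "\<mu> x = \<pi> x"
proof -
  define h where "h x = \<mu> x / \<pi> x" for x
  have \<mu>_h: "\<mu> x = \<pi> x * h x" if "x \<in> S" for x
    using pos[OF that] by (simp add: h_def)
  have harmonic: "h x = (\<Sum>y\<in>S. P x y * h y)" if x: "x \<in> S" for x
  proof -
    have "\<pi> x * h x = (\<Sum>y\<in>S. \<mu> y * P y x)"
      using \<mu> x \<mu>_h by (simp add: stationary_measure_def)
    also have "\<dots> = (\<Sum>y\<in>S. \<pi> y * P y x * h y)"
      using \<mu>_h by (intro sum.cong) auto
    also have "\<dots> = \<pi> x * (\<Sum>y\<in>S. P x y * h y)"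
      using balance x by (auto simp: sum_distrib_left mult.assoc[symmetric] intro!: sum.cong)
    finally show ?thesis using pos[OF x] by simp
  qed
  obtain b where b: "b \<in> S" "\<And>x. x \<in> S \<Longrightarrow> h x \<le> h b"
  proof -
    have "Max (h ` S) \<in> h ` S" using fin z by (intro Max_in) auto
    then show thesis using fin that by (metis (no_types, lifting) Max_ge finite_imageI imageE imageI)
  qed
  have maximum_spreads: "h y = h b" if x: "x \<in> S" "h x = h b" and y: "y \<in> S" "0 < P x y" for x y
  proof -
    have "(\<Sum>w\<in>S. P x w * (h b - h w)) = h b * (\<Sum>w\<in>S. P x w) - h x"
      using harmonic[OF x(1)] by (simp add: algebra_simps sum_subtractf sum_distrib_left)
    also have "\<dots> = 0" using stoch x by (simp add: stochastic_on_def)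
    finally have "\<forall>w\<in>S. P x w * (h b - h w) = 0"
      using stoch x b fin by (subst (asm) sum_nonneg_eq_0_iff) (auto simp: stochastic_on_def)
    then show ?thesis using y by auto
  qed
  have "h z = h b" using maximum_spreads[OF b(1) _ z to_z] b by simp
  then have const: "h x = h b" if "x \<in> S" for x
    using maximum_spreads[OF z _ that from_z] that by simp
  have "1 = (\<Sum>x\<in>S. \<mu> x)" using \<mu> by (simp add: stationary_measure_def distribution_on_def)
  also have "\<dots> = (\<Sum>x\<in>S. \<pi> x * h b)" using \<mu>_h const by (intro sum.cong) auto
  also have "\<dots> = h b" using dist by (simp add: distribution_on_def flip: sum_distrib_right)
  finally show ?thesis using \<mu>_h const \<open>x \<in> S\<close> by simp
qed

end

lemma stationary_if_reversible:
  assumes "stochastic_on S P" "distribution_on S \<pi>"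
    and "\<And>x y. x \<in> S \<Longrightarrow> y \<in> S \<Longrightarrow> \<pi> x * P x y = \<pi> y * P y x"
  shows "stationary_measure S P \<pi>"
proof -
  have "(\<Sum>x\<in>S. \<pi> x * P x y) = \<pi> y" if "y \<in> S" for y
  proof -
    have "(\<Sum>x\<in>S. \<pi> x * P x y) = (\<Sum>x\<in>S. \<pi> y * P y x)"
      using assms(3) that by (intro sum.cong) auto
    then show ?thesis
      using assms(1) that by (simp add: stochastic_on_def flip: sum_distrib_left)
  qed
  then show ?thesis using assms(2) by (simp add: stationary_measure_def)
qed

lemma rank_stationary_distribution:
  assumes "1 < q"
  shows "distribution_on {0..int n} (rank_stationary q n)"
    and "\<And>h. h \<in> {0..int n} \<Longrightarrow> 0 < rank_stationary q n h"
proof -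
  have Z: "0 < (\<Sum>k\<in>{0..int n}. rank_weight q n k)"
    using rank_weight_pos[OF assms] by (intro sum_pos) auto
  show pos: "\<And>h. h \<in> {0..int n} \<Longrightarrow> 0 < rank_stationary q n h"
    unfolding rank_stationary_def using Z rank_weight_pos[OF assms] by simp
  show "distribution_on {0..int n} (rank_stationary q n)"
    unfolding distribution_on_def
    using pos Z by (auto simp: less_imp_le rank_stationary_def simp flip: sum_divide_distrib)
qed

section \<open>Dimension by counting\<close>

text \<open>Over a finite field, rank-nullity is Lagrange's theorem: all fibres of a homomorphism are cosets
of its kernel. The map \<open>f\<close> enters only through its kernel, so the same lemma serves for matrices,
for scalar products and for the projection to the first coordinates.\<close>

lemma card_eq_card_image_times_kernel:
  fixes W :: "'a::ring_1 vec set"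
  assumes "finite W" "W \<subseteq> carrier_vec N"
    and add: "\<And>v w. v \<in> W \<Longrightarrow> w \<in> W \<Longrightarrow> v + w \<in> W"
    and diff: "\<And>v w. v \<in> W \<Longrightarrow> w \<in> W \<Longrightarrow> v - w \<in> W"
    and "K \<subseteq> W" and kernel: "\<And>v w. v \<in> W \<Longrightarrow> w \<in> W \<Longrightarrow> f v = f w \<longleftrightarrow> v - w \<in> K"
  shows "card W = card (f ` W) * card K"
proof -
  have fibre: "card {w \<in> W. f w = f v} = card K" if v: "v \<in> W" for v
  proof (rule bij_betw_same_card[symmetric, of "\<lambda>k. k + v"], rule bij_betw_byWitness[of _ "\<lambda>w. w - v"])
    have carrier: "w \<in> carrier_vec N" if "w \<in> W" for w using assms(2) that by auto
    have cancel: "k + v - v = k" "w - v + v = w" if "k \<in> W" "w \<in> W" for k w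
      using carrier[OF v] carrier[OF that(1)] carrier[OF that(2)] by (auto intro!: eq_vecI)
    show "\<forall>k\<in>K. k + v - v = k" using cancel(1) v assms(5) by blast
    show "\<forall>w\<in>{w \<in> W. f w = f v}. w - v + v = w" using cancel(2) v by blast
    show "(\<lambda>k. k + v) ` K \<subseteq> {w \<in> W. f w = f v}"
      using v assms(5) add cancel(1) kernel by (auto simp: subset_iff)
    show "(\<lambda>w. w - v) ` {w \<in> W. f w = f v} \<subseteq> K"
      using v kernel by auto
  qed
  have "card W = (\<Sum>y\<in>f ` W. card {w \<in> W. f w = y})"
    unfolding card_eq_sum by (rule sum.image_gen[OF assms(1)])
  also have "\<dots> = (\<Sum>y\<in>f ` W. card K)"
    by (intro sum.cong) (auto simp: fibre)
  finally show ?thesis by simp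
qed

locale finite_vec_space = vec_space f_ty n for f_ty :: "'a::{field,finite} itself" and n
begin

abbreviation "linear_subspace W \<equiv> submodule class_ring W V"

lemma linear_subspaceD:
  assumes "linear_subspace W"
  shows "W \<subseteq> carrier_vec n" "0\<^sub>v n \<in> W"
    and "\<And>v w. v \<in> W \<Longrightarrow> w \<in> W \<Longrightarrow> v + w \<in> W"
    and "\<And>v c. v \<in> W \<Longrightarrow> c \<cdot>\<^sub>v v \<in> W"
    and "\<And>v w. v \<in> W \<Longrightarrow> w \<in> W \<Longrightarrow> v - w \<in> W"
    and "finite W"
proof -
  show carrier: "W \<subseteq> carrier_vec n" and "0\<^sub>v n \<in> W"
    and add: "\<And>v w. v \<in> W \<Longrightarrow> w \<in> W \<Longrightarrow> v + w \<in> W"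
    and smult: "\<And>v c. v \<in> W \<Longrightarrow> c \<cdot>\<^sub>v v \<in> W"
    using assms by (auto simp: submodule_def module_vec_simps class_ring_simps)
  fix v w assume "v \<in> W" "w \<in> W"
  moreover have "v - w = v + (-1) \<cdot>\<^sub>v w"
    using calculation carrier by (auto intro!: eq_vecI)
  ultimately show "v - w \<in> W" using add smult by simp
next
  show "finite W" using assms finite_carrier_vec finite_subset by (fastforce simp: submodule_def module_vec_simps)
qed

lemma linear_subspaceI:
  assumes "W \<subseteq> carrier_vec n" "0\<^sub>v n \<in> W"
    and "\<And>v w. v \<in> W \<Longrightarrow> w \<in> W \<Longrightarrow> v + w \<in> W"
    and "\<And>v c. v \<in> W \<Longrightarrow> c \<cdot>\<^sub>v v \<in> W"
  shows "linear_subspace W"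
  using assms by (intro submodule.intro) (auto simp: module_vec_simps class_ring_simps vec_module)

definition add_line :: "'a vec set \<Rightarrow> 'a vec \<Rightarrow> 'a vec set" where
  "add_line W v = (\<lambda>(w, c). w + c \<cdot>\<^sub>v v) ` (W \<times> UNIV)"

lemma linear_subspace_add_line:
  assumes W: "linear_subspace W" and v: "v \<in> carrier_vec n"
  shows "linear_subspace (add_line W v)"
proof (rule linear_subspaceI)
  note W' = linear_subspaceD[OF W]
  show "add_line W v \<subseteq> carrier_vec n"
    using W'(1) v by (auto simp: add_line_def)
  have "0\<^sub>v n = 0\<^sub>v n + 0 \<cdot>\<^sub>v v" using v by auto
  then show "0\<^sub>v n \<in> add_line W v"
    using W'(2) unfolding add_line_def by (intro image_eqI[of _ _ "(0\<^sub>v n, 0)"]) auto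
  fix x y assume "x \<in> add_line W v" "y \<in> add_line W v"
  then obtain w c w' c' where xy: "x = w + c \<cdot>\<^sub>v v" "y = w' + c' \<cdot>\<^sub>v v" "w \<in> W" "w' \<in> W"
    by (auto simp: add_line_def)
  have "x + y = (w + w') + (c + c') \<cdot>\<^sub>v v"
    using xy W'(1) v by (auto intro!: eq_vecI simp: algebra_simps subset_iff)
  then show "x + y \<in> add_line W v"
    using xy W'(3) unfolding add_line_def by (intro image_eqI[of _ _ "(w + w', c + c')"]) auto
next
  note W' = linear_subspaceD[OF W]
  fix x a assume "x \<in> add_line W v"
  then obtain w c where x: "x = w + c \<cdot>\<^sub>v v" "w \<in> W"
    by (auto simp: add_line_def)
  have "a \<cdot>\<^sub>v x = a \<cdot>\<^sub>v w + (a * c) \<cdot>\<^sub>v v"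
    using x W'(1) v by (auto intro!: eq_vecI simp: algebra_simps subset_iff)
  then show "a \<cdot>\<^sub>v x \<in> add_line W v"
    using x W'(4) unfolding add_line_def by (intro image_eqI[of _ _ "(a \<cdot>\<^sub>v w, a * c)"]) auto
qed

lemma card_add_line:
  assumes W: "linear_subspace W" and v: "v \<in> carrier_vec n" "v \<notin> W" and "U \<subseteq> W"
  shows "card (add_line U v) = CARD('a) * card U"
proof -
  note W' = linear_subspaceD[OF W]
  have "inj_on (\<lambda>(w, c). w + c \<cdot>\<^sub>v v) (U \<times> UNIV)"
  proof (rule inj_onI, clarify)
    fix w c w' c'
    assume w: "w \<in> U" "w' \<in> U" and eq: "w + c \<cdot>\<^sub>v v = w' + c' \<cdot>\<^sub>v v"
    have wc: "w \<in> W" "w' \<in> W" "w \<in> carrier_vec n" "w' \<in> carrier_vec n"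
      using w \<open>U \<subseteq> W\<close> W'(1) by auto
    have idx: "w $ i + c * v $ i = w' $ i + c' * v $ i" if "i < n" for i
      using arg_cong[OF eq, of "\<lambda>x. x $ i"] that wc v by simp
    have "c = c'"
    proof (rule ccontr)
      assume "c \<noteq> c'"
      have "v = (1 / (c' - c)) \<cdot>\<^sub>v (w - w')"
      proof (rule eq_vecI)
        fix i assume "i < dim_vec ((1 / (c' - c)) \<cdot>\<^sub>v (w - w'))"
        then have i: "i < n" using wc by simp
        have "(c' - c) * v $ i = w $ i - w' $ i" using idx[OF i] by (simp add: algebra_simps)
        then show "v $ i = ((1 / (c' - c)) \<cdot>\<^sub>v (w - w')) $ i"
          using i wc \<open>c \<noteq> c'\<close> by (simp add: field_simps)
      qed (use wc v in auto)
      then show False using W'(4,5) wc v by metis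
    qed
    moreover from this have "w = w'" using idx wc by (intro eq_vecI) auto
    ultimately show "w = w' \<and> c = c'" by simp
  qed
  then show ?thesis by (simp add: add_line_def card_image card_cartesian_product)
qed

text \<open>With \<open>card_add_line\<close>, this says that a new vector either leaves the span unchanged or multiplies its
cardinality by \<open>q\<close>. All later counts reduce to this dichotomy.\<close>

lemma span_insert_eq_add_line:
  assumes S: "S \<subseteq> carrier_vec n" and v: "v \<in> carrier_vec n"
  shows "span (insert v S) = add_line (span S) v"
proof
  have sub: "linear_subspace (span S)" "linear_subspace (span (insert v S))"
    using span_is_submodule S v by auto
  have "s \<in> add_line (span S) v" if "s \<in> S" for s
  proof -
    have "s \<in> carrier_vec n" "s \<in> span S" using that S in_own_span[of S] by auto
    moreover from this have "s = s + 0 \<cdot>\<^sub>v v" using v by auto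
    ultimately show ?thesis unfolding add_line_def by (intro image_eqI[of _ _ "(s, 0)"]) auto
  qed
  moreover have "v \<in> add_line (span S) v"
    using v linear_subspaceD(2)[OF sub(1)] unfolding add_line_def
    by (intro image_eqI[of _ _ "(0\<^sub>v n, 1)"]) auto
  ultimately show "span (insert v S) \<subseteq> add_line (span S) v"
    using linear_subspace_add_line[OF sub(1) v] by (intro span_is_subset) auto
  have "span S \<subseteq> span (insert v S)" by (intro span_is_monotone) auto
  moreover have "v \<in> span (insert v S)" using in_own_span[of "insert v S"] S v by auto
  ultimately show "add_line (span S) v \<subseteq> span (insert v S)"
    using linear_subspaceD(3,4)[OF sub(2)] by (auto simp: add_line_def)
qed

lemma span_insert_absorb:
  assumes "S \<subseteq> carrier_vec n" "v \<in> span S"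
  shows "span (insert v S) = span S"
  using already_in_span[OF _ assms(2)] assms(1) by simp

lemma card_span_insert:
  assumes "S \<subseteq> carrier_vec n" "v \<in> carrier_vec n" "v \<notin> span S"
  shows "card (span (insert v S)) = CARD('a) * card (span S)"
  using card_add_line[OF span_is_submodule, of S v "span S"] assms by (simp add: span_insert_eq_add_line)

text \<open>A vector chosen inside \<open>E\<close> enlarges the intersection of the span with \<open>E\<close> by the same factor as the
span itself. This keeps the count of the next choices in \<open>E\<close> under control.\<close>

lemma card_span_insert_Int:
  assumes S: "S \<subseteq> carrier_vec n" and E: "linear_subspace E" and v: "v \<in> E" "v \<notin> span S"
  shows "card (span (insert v S) \<inter> E) = CARD('a) * card (span S \<inter> E)"
proof -
  note E' = linear_subspaceD[OF E]
  have sub: "linear_subspace (span S)" using span_is_submodule S by auto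
  have v': "v \<in> carrier_vec n" using v E'(1) by auto
  have "add_line (span S) v \<inter> E = add_line (span S \<inter> E) v"
  proof (intro equalityI subsetI)
    fix x assume "x \<in> add_line (span S) v \<inter> E"
    then obtain w c where x: "x = w + c \<cdot>\<^sub>v v" "w \<in> span S" "x \<in> E" by (auto simp: add_line_def)
    have "w = x - c \<cdot>\<^sub>v v"
      using x linear_subspaceD(1)[OF sub] v' by (auto intro!: eq_vecI)
    then have "w \<in> E" using E' x v by metis
    then show "x \<in> add_line (span S \<inter> E) v" using x by (auto simp: add_line_def)
  qed (use E' v in \<open>auto simp: add_line_def\<close>)
  then show ?thesis
    using S v v' sub by (simp add: span_insert_eq_add_line card_add_line[OF sub])
qed

lemma card_span_lin_indpt:
  assumes "finite U" "U \<subseteq> carrier_vec n" "lin_indpt U"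
  shows "card (span U) = CARD('a) ^ card U"
  using assms
proof (induction U)
  case empty
  then show ?case by (simp add: span_empty)
next
  case (insert v U)
  have "lin_indpt U" using insert.prems(2) subset_li_is_li[of "insert v U" U] by auto
  moreover have "v \<notin> span U"
    using lin_dep_iff_in_span[of U v] insert.prems insert.hyps calculation by auto
  ultimately show ?case
    using insert by (simp add: card_span_insert)
qed

lemma card_span_cols:
  assumes A: "A \<in> carrier_mat n nc"
  shows "card (span (set (cols A))) = CARD('a) ^ rank A"
proof -
  have cols: "set (cols A) \<subseteq> carrier_vec n" using cols_dim A by blast
  obtain U where U: "maximal U (\<lambda>T. T \<subseteq> set (cols A) \<and> lin_indpt T)" "finite U"
    using maximal_exists_superset[of "set (cols A)" "\<lambda>T. T \<subseteq> set (cols A) \<and> lin_indpt T" "{}"]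
      finite_lin_indpt2[of "{}"] by auto
  then have U': "U \<subseteq> set (cols A)" "lin_indpt U" by (auto simp: maximal_def)
  have "c \<in> span U" if "c \<in> set (cols A)" for c
  proof (cases "c \<in> U")
    case True
    then show ?thesis using in_own_span[of U] U' cols by auto
  next
    case False
    then have "lin_dep (U \<union> {c})" using U(1) U' that by (auto simp: maximal_def)
    then show ?thesis using lin_dep_iff_in_span[of U c] U' cols that False by auto
  qed
  then have "span (set (cols A)) = span U"
    using span_is_monotone[OF U'(1)] span_is_subset[of "set (cols A)" "span U"] span_is_submodule[of U] U' cols
    by auto
  then show ?thesis
    using rank_card_indpt[OF A U(1)] card_span_lin_indpt[OF U(2) _ U'(2)] U' cols by auto
qed

end

lemma one_less_card_field: "1 < CARD('a::{field,finite})"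
proof -
  have "card {0, 1 :: 'a} \<le> CARD('a)" by (intro card_mono) auto
  then show ?thesis by simp
qed

context finite_vec_space begin

text \<open>The central count. Choose \<open>k\<close> vectors of \<open>E\<close> one after the other and look at the growth of
\<open>span S\<close>. A choice is wasted exactly if it falls into \<open>span S \<inter> E\<close>, which has \<open>q ^ d\<close> elements, and
otherwise \<open>d\<close> grows by one. The outcome therefore depends on \<open>S\<close> only through \<open>d\<close>, and it is the
count of \<open>(m - d) \<times> k\<close> matrices of rank \<open>r\<close>, multiplied by the \<open>q ^ (d * k)\<close> ways of lifting
vectors of the quotient of \<open>E\<close> by \<open>span S \<inter> E\<close> to \<open>E\<close>.\<close>

lemma card_spanning_extensions:
  fixes q m :: nat
  assumes q: "q = CARD('a)" and E: "linear_subspace E" "card E = q ^ m"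
    and "S \<subseteq> carrier_vec n" "card (span S \<inter> E) = q ^ d"
  shows "real (card {bs. set bs \<subseteq> E \<and> length bs = k \<and> card (span (S \<union> set bs)) = q ^ r * card (span S)}) =
    real q ^ (d * k) * rank_count (real q) (m - d) k r"
  using assms(4,5)
proof (induction k arbitrary: S d r)
  case 0
  have "0 < card (span S)"
    using linear_subspaceD(2,6)[OF span_is_submodule[of S]] 0 by (auto simp: card_gt_0_iff)
  moreover have "1 < q ^ r" if "0 < r"
    using one_less_card_field[where 'a='a] that unfolding q by (intro one_less_power)
  ultimately have "card (span S) = q ^ r * card (span S) \<longleftrightarrow> r = 0"
    by (cases "r = 0") force+
  then have "{bs. set bs \<subseteq> E \<and> length bs = 0 \<and> card (span (S \<union> set bs)) = q ^ r * card (span S)} =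
      (if r = 0 then {[]} else {})"
    by (auto simp del: mult_cancel2 mult_eq_self_implies_10)
  then show ?case by (auto simp: rank_count_eq_0)
next
  case (Suc k)
  note S = Suc.prems(1)
  note E' = linear_subspaceD[OF E(1)]
  have q1: "1 < q" unfolding q by (rule one_less_card_field)
  define X where "X S k r = {bs. set bs \<subseteq> E \<and> length bs = k \<and> card (span (S \<union> set bs)) = q ^ r * card (span S)}"
    for S k r
  \<comment> \<open>\<open>Y b\<close> collects the tails of the lists that start with \<open>b\<close>.\<close>
  define Y where "Y b = {bs. set bs \<subseteq> E \<and> length bs = k \<and>
    card (span (insert b (S \<union> set bs))) = q ^ r * card (span S)}" for b
  define x where "x = real q ^ (d * k) * rank_count (real q) (m - d) k r"
  define y where "y = (case r of 0 \<Rightarrow> 0 | Suc r' \<Rightarrow> real q ^ (Suc d * k) * rank_count (real q) (m - Suc d) k r')"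
  have finY: "finite (Y b)" for b
    using finite_lists_length_eq[OF E'(6), of k] by (rule finite_subset[rotated]) (auto simp: Y_def)
  have old: "real (card (Y b)) = x" if b: "b \<in> span S \<inter> E" for b
  proof -
    have "Y b = X S k r"
      unfolding Y_def X_def
    proof (intro Collect_cong conj_cong refl)
      fix bs assume "set bs \<subseteq> E"
      then have "S \<union> set bs \<subseteq> carrier_vec n" using S E'(1) by auto
      moreover have "b \<in> span (S \<union> set bs)"
        using b span_is_monotone[of S "S \<union> set bs"] by auto
      ultimately show "(card (span (insert b (S \<union> set bs))) = q ^ r * card (span S)) =
          (card (span (S \<union> set bs)) = q ^ r * card (span S))"
        by (simp add: span_insert_absorb)
    qed
    then show ?thesis using Suc.IH[OF Suc.prems] by (simp add: X_def x_def)
  qed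
  have new: "real (card (Y b)) = y" if b: "b \<in> E - span S" for b
  proof -
    have b': "b \<in> carrier_vec n" "insert b S \<subseteq> carrier_vec n" using b E'(1) S by auto
    have grow: "card (span (insert b S)) = q * card (span S)"
      using card_span_insert[OF S b'(1)] b unfolding q by auto
    have pos: "0 < card (span S)"
      using linear_subspaceD(2,6)[OF span_is_submodule[of S]] S by (auto simp: card_gt_0_iff)
    show ?thesis
    proof (cases r)
      case 0
      have "card (span S) < card (span (insert b (S \<union> set bs)))" if "set bs \<subseteq> E" for bs
      proof -
        have "card (span S) < q * card (span S)" using pos q1 by simp
        also have "\<dots> \<le> card (span (insert b (S \<union> set bs)))"
          unfolding grow[symmetric] using that b' E'(1)
          by (intro card_mono span_is_monotone linear_subspaceD(6) span_is_submodule) auto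
        finally show ?thesis .
      qed
      then have "Y b = {}" using 0 by (force simp: Y_def)
      then show ?thesis using 0 by (simp add: y_def)
    next
      case (Suc r')
      have "Y b = X (insert b S) k r'"
        unfolding Y_def X_def grow Suc by (simp add: mult_ac)
      moreover have d: "card (span (insert b S) \<inter> E) = q ^ Suc d"
        using card_span_insert_Int[OF S E(1)] b Suc.prems(2) unfolding q by auto
      ultimately show ?thesis
        using Suc.IH[OF b'(2) d, of r'] by (simp add: X_def y_def Suc)
    qed
  qed
  have "X S (Suc k) r = (\<lambda>(b, bs). b # bs) ` Sigma E Y"
  proof (intro equalityI subsetI)
    fix bs assume bs: "bs \<in> X S (Suc k) r"
    then obtain b bs' where "bs = b # bs'" by (cases bs) (auto simp: X_def)
    then show "bs \<in> (\<lambda>(b, bs). b # bs) ` Sigma E Y"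
      using bs by (intro image_eqI[of _ _ "(b, bs')"]) (auto simp: X_def Y_def)
  qed (auto simp: X_def Y_def)
  moreover have "inj_on (\<lambda>(b, bs). b # bs) (Sigma E Y)"
    by (rule inj_onI) auto
  ultimately have "card (X S (Suc k) r) = card (Sigma E Y)"
    by (simp add: card_image)
  also have "\<dots> = (\<Sum>b\<in>E. card (Y b))"
    using E'(6) finY by (intro card_SigmaI) auto
  also have "real \<dots> = (\<Sum>b\<in>span S \<inter> E. real (card (Y b))) + (\<Sum>b\<in>E - span S. real (card (Y b)))"
    using sum.Int_Diff[OF E'(6), of "\<lambda>b. real (card (Y b))" "span S"] by (simp add: Int_commute)
  also have "\<dots> = real (card (span S \<inter> E)) * x + real (card (E - span S)) * y"
    using old new by simp
  also have "card (E - span S) = q ^ m - q ^ d"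
    using card_Diff_subset_Int[of E "span S"] E'(6) E(2) Suc.prems(2) by (simp add: Int_commute)
  finally have rec: "real (card (X S (Suc k) r)) = real q ^ d * x + real (q ^ m - q ^ d) * y"
    using Suc.prems(2) by simp
  have "q ^ d \<le> q ^ m"
    using card_mono[OF E'(6), of "span S \<inter> E"] E(2) Suc.prems(2) by simp
  then have "d \<le> m" using q1 by simp
  have "real (card (X S (Suc k) r)) = real q ^ (d * Suc k) * rank_count (real q) (m - d) (Suc k) r"
  proof (cases r)
    case 0
    then show ?thesis using rec by (simp add: x_def y_def power_add)
  next
    case r: (Suc r')
    show ?thesis
    proof (cases "d = m")
      case True
      then show ?thesis using rec by (simp add: x_def r rank_count_eq_0)
    next
      case False
      define j where "j = m - Suc d"
      have m: "m = Suc (d + j)" using \<open>d \<le> m\<close> False by (simp add: j_def)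
      show ?thesis
        using q1 \<open>q ^ d \<le> q ^ m\<close> rec
        by (simp add: x_def y_def r m Suc_diff_le rank_count_Suc_Suc of_nat_diff power_add algebra_simps)
    qed
  qed
  then show ?case by (simp add: X_def)
qed

end

section \<open>Row rank equals column rank\<close>

lemma range_mult_mat_vec:
  assumes "A \<in> carrier_mat nr nc"
  shows "module.span class_ring (module_vec TYPE('a::field) nr) (set (cols A)) = (\<lambda>x. A *\<^sub>v x) ` carrier_vec nc"
proof -
  interpret vec_space "TYPE('a)" nr .
  show ?thesis
    using col_space_eq[OF assms] assms unfolding col_space_def by auto
qed

lemma card_range_mult_mat_vec:
  fixes A :: "'a::{field,finite} mat"
  assumes A: "A \<in> carrier_mat nr nc"
  shows "card ((\<lambda>x. A *\<^sub>v x) ` carrier_vec nc) = CARD('a) ^ vec_space.rank nr A"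
proof -
  interpret finite_vec_space "TYPE('a)" nr .
  show ?thesis using card_span_cols[OF A] range_mult_mat_vec[OF A] by simp
qed

lemma mult_mat_vec_eq_iff:
  fixes A :: "'a::field mat"
  assumes "A \<in> carrier_mat nr nc" "x \<in> carrier_vec nc" "y \<in> carrier_vec nc"
  shows "A *\<^sub>v x = A *\<^sub>v y \<longleftrightarrow> A *\<^sub>v (x - y) = 0\<^sub>v nr"
proof -
  have "A *\<^sub>v x = A *\<^sub>v y \<longleftrightarrow> A *\<^sub>v x - A *\<^sub>v y = 0\<^sub>v nr"
    using assms by (auto simp: vec_eq_iff)
  then show ?thesis using mult_minus_distrib_mat_vec[OF assms] by simp
qed

lemma card_kernel_times_rank:
  fixes A :: "'a::{field,finite} mat"
  assumes A: "A \<in> carrier_mat nr nc"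
  shows "CARD('a) ^ nc = CARD('a) ^ vec_space.rank nr A * card {x \<in> carrier_vec nc. A *\<^sub>v x = 0\<^sub>v nr}"
  using card_eq_card_image_times_kernel[of "carrier_vec nc" nc
    "{x \<in> carrier_vec nc. A *\<^sub>v x = 0\<^sub>v nr}" "\<lambda>x. A *\<^sub>v x"] mult_mat_vec_eq_iff[OF A] card_range_mult_mat_vec[OF A]
  by (simp add: card_carrier_vec)

lemma card_hyperplane:
  fixes v :: "'a::{field,finite} vec"
  assumes v: "v \<in> carrier_vec m" "v \<noteq> 0\<^sub>v m"
  shows "CARD('a) * card {y \<in> carrier_vec m. scalar_prod y v = 0} = CARD('a) ^ m"
proof -
  obtain i where i: "i < m" "v $ i \<noteq> 0" using v by (auto simp: vec_eq_iff)
  have "scalar_prod ((c / v $ i) \<cdot>\<^sub>v unit_vec m i) v = c" for c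
    using v i by (simp add: scalar_prod_left_unit)
  then have "c \<in> (\<lambda>y. scalar_prod y v) ` carrier_vec m" for c
    by (intro image_eqI[of _ _ "(c / v $ i) \<cdot>\<^sub>v unit_vec m i"]) auto
  then have "(\<lambda>y. scalar_prod y v) ` carrier_vec m = UNIV"
    by blast
  moreover have "scalar_prod x v = scalar_prod y v \<longleftrightarrow> scalar_prod (x - y) v = 0"
    if "x \<in> carrier_vec m" "y \<in> carrier_vec m" for x y
    using minus_scalar_prod_distrib[OF that v(1)] by simp
  ultimately show ?thesis
    using card_eq_card_image_times_kernel[of "carrier_vec m" m
      "{y \<in> carrier_vec m. scalar_prod y v = 0}" "\<lambda>y. scalar_prod y v"]
    by (simp add: card_carrier_vec)
qed

text \<open>For fixed \<open>x\<close>, the solutions \<open>y\<close> of \<open>y \<bullet> (A x) = 0\<close> form the whole space if \<open>x\<close> lies in the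
kernel of \<open>A\<close>, and a hyperplane otherwise.\<close>

lemma card_orthogonal_pairs:
  fixes A :: "'a::{field,finite} mat"
  assumes A: "A \<in> carrier_mat nr nc"
  shows "CARD('a) * (\<Sum>x\<in>carrier_vec nc. card {y \<in> carrier_vec nr. scalar_prod y (A *\<^sub>v x) = 0}) =
    CARD('a) ^ nr * (CARD('a) ^ nc + (CARD('a) - 1) * card {x \<in> carrier_vec nc. A *\<^sub>v x = 0\<^sub>v nr})"
proof -
  let ?K = "{x \<in> carrier_vec nc. A *\<^sub>v x = 0\<^sub>v nr}"
  have q: "CARD('a) = 1 + (CARD('a) - 1)" using one_less_card_field by simp
  have "CARD('a) * card {y \<in> carrier_vec nr. scalar_prod y (A *\<^sub>v x) = 0} =
      CARD('a) ^ nr * (1 + (if A *\<^sub>v x = 0\<^sub>v nr then CARD('a) - 1 else 0))" if "x \<in> carrier_vec nc" for x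
  proof (cases "A *\<^sub>v x = 0\<^sub>v nr")
    case True
    then have "{y \<in> carrier_vec nr. scalar_prod y (A *\<^sub>v x) = 0} = carrier_vec nr" by auto
    then show ?thesis using True q by (simp add: card_carrier_vec mult.commute)
  qed (use card_hyperplane[of "A *\<^sub>v x" nr] A that in simp)
  then have "CARD('a) * (\<Sum>x\<in>carrier_vec nc. card {y \<in> carrier_vec nr. scalar_prod y (A *\<^sub>v x) = 0}) =
      (\<Sum>x\<in>carrier_vec nc. CARD('a) ^ nr * (1 + (if A *\<^sub>v x = 0\<^sub>v nr then CARD('a) - 1 else 0)))"
    unfolding sum_distrib_left by (intro sum.cong) auto
  also have "\<dots> = CARD('a) ^ nr * (card (carrier_vec nc :: 'a vec set) + card ?K * (CARD('a) - 1))"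
    by (simp add: sum.distrib sum.If_cases Int_def flip: sum_distrib_left) (simp add: algebra_simps)
  finally show ?thesis by (simp add: card_carrier_vec mult.commute)
qed

text \<open>Double counting of the pairs \<open>(x, y)\<close> with \<open>y \<bullet> (A x) = 0\<close>: as this equals \<open>(A\<^sup>T y) \<bullet> x\<close>, the
same number is expressed once by the kernel of \<open>A\<close> and once by the kernel of \<open>A\<^sup>T\<close>.\<close>

lemma rank_transpose:
  fixes A :: "'a::{field,finite} mat"
  assumes A: "A \<in> carrier_mat nr nc"
  shows "vec_space.rank nc A\<^sup>T = vec_space.rank nr A"
proof -
  let ?q = "CARD('a)"
  define K where "K = card {x \<in> carrier_vec nc. A *\<^sub>v x = 0\<^sub>v nr}"
  define L where "L = card {y \<in> carrier_vec nr. A\<^sup>T *\<^sub>v y = 0\<^sub>v nc}"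
  define p where "p = ?q - 1"
  have AT: "A\<^sup>T \<in> carrier_mat nc nr" using A by simp
  have adjoint: "scalar_prod x (A\<^sup>T *\<^sub>v y) = scalar_prod y (A *\<^sub>v x)"
    if "x \<in> carrier_vec nc" "y \<in> carrier_vec nr" for x y
    using transpose_vec_mult_scalar[OF A that] comm_scalar_prod[of x nc "A\<^sup>T *\<^sub>v y"] that A by simp
  have "(\<Sum>x\<in>carrier_vec nc. card {y \<in> carrier_vec nr. scalar_prod y (A *\<^sub>v x) = 0}) =
      (\<Sum>x\<in>carrier_vec nc. \<Sum>y\<in>carrier_vec nr. if scalar_prod y (A *\<^sub>v x) = 0 then 1 else 0)"
    by (intro sum.cong) (auto simp: sum.If_cases Int_def)
  also have "\<dots> = (\<Sum>y\<in>carrier_vec nr. \<Sum>x\<in>carrier_vec nc. if scalar_prod x (A\<^sup>T *\<^sub>v y) = 0 then 1 else 0)"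
    by (subst sum.swap, intro sum.cong refl) (simp add: adjoint)
  also have "\<dots> = (\<Sum>y\<in>carrier_vec nr. card {x \<in> carrier_vec nc. scalar_prod x (A\<^sup>T *\<^sub>v y) = 0})"
    by (intro sum.cong) (auto simp: sum.If_cases Int_def)
  finally have "?q ^ nr * (?q ^ nc + p * K) = ?q ^ nc * (?q ^ nr + p * L)"
    using card_orthogonal_pairs[OF A] card_orthogonal_pairs[OF AT] by (simp add: K_def L_def p_def)
  then have "?q ^ nr * K = ?q ^ nc * L"
    using one_less_card_field[where 'a='a] by (simp add: algebra_simps p_def[symmetric]) (simp add: p_def)
  moreover have nc: "?q ^ nc = ?q ^ vec_space.rank nr A * K" and nr: "?q ^ nr = ?q ^ vec_space.rank nc A\<^sup>T * L"
    using card_kernel_times_rank[OF A] card_kernel_times_rank[OF AT] by (simp_all add: K_def L_def)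
  ultimately have "?q ^ vec_space.rank nc A\<^sup>T * (K * L) = ?q ^ vec_space.rank nr A * (K * L)"
    by (simp add: mult_ac)
  moreover have "0 < K" "0 < L" using nc nr one_less_card_field[where 'a='a] by (auto intro: gr0I)
  ultimately show ?thesis using one_less_card_field[where 'a='a] by simp
qed

section \<open>Completing a block matrix\<close>

text \<open>The projection to the first \<open>p\<close> coordinates maps the column space of \<open>C1 @\<^sub>r C2\<close> onto the column
space of \<open>C1\<close>; its kernel is the intersection with the space \<open>E\<close> of vectors that live on the last
\<open>m\<close> coordinates. Hence the rank gained by the rows \<open>C2\<close> is the dimension of that intersection. In
the chain this identifies the previous increment with the quantity \<open>d\<close> of
\<open>card_spanning_extensions\<close>.\<close>

lemma append_rows_rank:
  fixes C1 C2 :: "'a::{field,finite} mat"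
  assumes C1: "C1 \<in> carrier_mat p c" and C2: "C2 \<in> carrier_mat m c"
  defines "E \<equiv> (\<lambda>b :: 'a vec. 0\<^sub>v p @\<^sub>v b) ` carrier_vec m"
  shows "vec_space.rank p C1 \<le> vec_space.rank (p + m) (C1 @\<^sub>r C2)"
    and "vec_space.rank (p + m) (C1 @\<^sub>r C2) \<le> vec_space.rank p C1 + m"
    and "card (module.span class_ring (module_vec TYPE('a) (p + m)) (set (cols (C1 @\<^sub>r C2))) \<inter> E) =
      CARD('a) ^ (vec_space.rank (p + m) (C1 @\<^sub>r C2) - vec_space.rank p C1)"
    and "submodule class_ring E (module_vec TYPE('a) (p + m))" "card E = CARD('a) ^ m"
proof -
  interpret finite_vec_space "TYPE('a)" "p + m" .
  let ?q = "CARD('a)" and ?C = "C1 @\<^sub>r C2"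
  let ?W = "span (set (cols ?C))"
  have C: "?C \<in> carrier_mat (p + m) c" using C1 C2 by simp
  have W: "?W = (\<lambda>x. (C1 *\<^sub>v x) @\<^sub>v (C2 *\<^sub>v x)) ` carrier_vec c"
    unfolding range_mult_mat_vec[OF C] using mat_mult_append[OF C1 C2] by (intro image_cong) auto
  have sub: "linear_subspace ?W" using span_is_submodule cols_dim[of ?C] C by auto
  note W' = linear_subspaceD[OF sub]
  have E: "E = {v \<in> carrier_vec (p + m). vec_first v p = 0\<^sub>v p}"
  proof (intro equalityI subsetI)
    fix v :: "'a vec" assume v: "v \<in> {v \<in> carrier_vec (p + m). vec_first v p = 0\<^sub>v p}"
    then have "v = 0\<^sub>v p @\<^sub>v vec_last v m" using vec_first_last_append[of v p m] by simp
    then show "v \<in> E" unfolding E_def by auto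
  qed (auto simp: E_def vec_first_def)
  show subE: "linear_subspace E"
    unfolding E by (rule linear_subspaceI) (auto simp: vec_first_def vec_eq_iff)
  have "inj_on (\<lambda>b. 0\<^sub>v p @\<^sub>v b) (carrier_vec m :: 'a vec set)"
    by (rule inj_onI) (simp add: append_vec_eq[OF zero_carrier_vec zero_carrier_vec])
  then show cardE: "card E = ?q ^ m" unfolding E_def by (simp add: card_image card_carrier_vec)
  have "(\<lambda>v. vec_first v p) ` ?W = (\<lambda>x. C1 *\<^sub>v x) ` carrier_vec c"
    unfolding W image_image using C1 by (intro image_cong) (auto simp: vec_first_def intro!: eq_vecI)
  moreover have "vec_first v p = vec_first w p \<longleftrightarrow> v - w \<in> ?W \<inter> E" if "v \<in> ?W" "w \<in> ?W" for v w
  proof -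
    have "v - w \<in> ?W" "v \<in> carrier_vec (p + m)" "w \<in> carrier_vec (p + m)"
      using W' that by auto
    then show ?thesis unfolding E by (auto simp: vec_first_def vec_eq_iff)
  qed
  ultimately have "card ?W = card ((\<lambda>x. C1 *\<^sub>v x) ` carrier_vec c) * card (?W \<inter> E)"
    using card_eq_card_image_times_kernel[OF W'(6,1,3,5), of "?W \<inter> E" "\<lambda>v. vec_first v p"] by simp
  then have split: "?q ^ rank ?C = ?q ^ vec_space.rank p C1 * card (?W \<inter> E)"
    using card_range_mult_mat_vec[OF C1] card_span_cols[OF C] by simp
  then have "?q ^ vec_space.rank p C1 dvd ?q ^ rank ?C" by simp
  then show le: "vec_space.rank p C1 \<le> rank ?C"
    using power_dvd_imp_le[of ?q] one_less_card_field[where 'a='a] by blast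
  then have "?q ^ rank ?C = ?q ^ vec_space.rank p C1 * ?q ^ (rank ?C - vec_space.rank p C1)"
    by (simp flip: power_add)
  then show card: "card (?W \<inter> E) = ?q ^ (rank ?C - vec_space.rank p C1)"
    using split one_less_card_field[where 'a='a] by simp
  have "card (?W \<inter> E) \<le> card E" using linear_subspaceD(6)[OF subE] by (intro card_mono) auto
  then have "rank ?C - vec_space.rank p C1 \<le> m"
    unfolding card cardE using one_less_card_field[where 'a='a] by simp
  then show "rank ?C \<le> vec_space.rank p C1 + m" by simp
qed

lemma cols_four_block_zero:
  assumes "C1 \<in> carrier_mat p c" "C2 \<in> carrier_mat m c" "B \<in> carrier_mat m k"
  shows "set (cols (four_block_mat C1 (0\<^sub>m p k) C2 B)) =
    set (cols (C1 @\<^sub>r C2)) \<union> set (map (\<lambda>b. 0\<^sub>v p @\<^sub>v b) (cols B))"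
proof -
  have Z: "0\<^sub>m p k \<in> carrier_mat p k" by simp
  have "cols (four_block_mat C1 (0\<^sub>m p k) C2 B) = cols (C1 @\<^sub>r C2) @ map (\<lambda>b. 0\<^sub>v p @\<^sub>v b) (cols B)"
    using assms by (intro nth_equalityI)
      (auto simp: nth_append append_rows_def col_four_block_mat[OF assms(1) Z assms(2,3)]
        col_four_block_mat[OF assms(1) _ assms(2), of _ 0])
  then show ?thesis by simp
qed

text \<open>The columns \<open>(0, b)\<close> added by the block \<open>B\<close> are arbitrary vectors of the space \<open>E\<close> above, so this is
\<open>card_spanning_extensions\<close> with \<open>S\<close> the set of columns of \<open>C1 @\<^sub>r C2\<close>.\<close>

lemma card_block_completions:
  fixes C1 C2 :: "'a::{field,finite} mat"
  assumes C1: "C1 \<in> carrier_mat p c" and C2: "C2 \<in> carrier_mat m c"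
    and d: "vec_space.rank (p + m) (C1 @\<^sub>r C2) = vec_space.rank p C1 + d"
  shows "real (card {B \<in> carrier_mat m k.
      vec_space.rank (p + m) (four_block_mat C1 (0\<^sub>m p k) C2 B) = vec_space.rank (p + m) (C1 @\<^sub>r C2) + r}) =
    real CARD('a) ^ (d * k) * rank_count (real CARD('a)) (m - d) k r"
proof -
  interpret finite_vec_space "TYPE('a)" "p + m" .
  let ?q = "CARD('a)" and ?C = "C1 @\<^sub>r C2" and ?C' = "\<lambda>B. four_block_mat C1 (0\<^sub>m p k) C2 B"
  let ?S = "set (cols ?C)" and ?emb = "\<lambda>b :: 'a vec. 0\<^sub>v p @\<^sub>v b"
  define E where "E = ?emb ` carrier_vec m"
  note prefix = append_rows_rank[OF C1 C2, folded E_def]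
  have C: "?C \<in> carrier_mat (p + m) c" using C1 C2 by simp
  have S: "?S \<subseteq> carrier_vec (p + m)" using cols_dim[of ?C] C by auto
  have d': "card (span ?S \<inter> E) = ?q ^ d" using prefix(3) d by simp
  let ?X = "{bs. set bs \<subseteq> E \<and> length bs = k \<and> card (span (?S \<union> set bs)) = ?q ^ r * card (span ?S)}"
  have rank_iff: "rank (?C' B) = rank ?C + r \<longleftrightarrow> card (span (?S \<union> set (map ?emb (cols B)))) = ?q ^ r * card (span ?S)"
    if B: "B \<in> carrier_mat m k" for B
  proof -
    have "?C' B \<in> carrier_mat (p + m) (c + k)" using C1 B by simp
    from card_span_cols[OF this] show ?thesis
      unfolding cols_four_block_zero[OF C1 C2 B] card_span_cols[OF C] using one_less_card_field[where 'a='a]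
      by (auto simp: add.commute simp flip: power_add)
  qed
  have "bij_betw (\<lambda>B. map ?emb (cols B)) {B \<in> carrier_mat m k. rank (?C' B) = rank ?C + r} ?X"
  proof (rule bij_betw_byWitness[of _ "\<lambda>bs. mat_of_cols m (map (\<lambda>v. vec_last v m) bs)"])
    have last: "vec_last (?emb b) m = b" if "b \<in> carrier_vec m" for b
      using that by (auto simp: vec_last_def)
    show "\<forall>B\<in>{B \<in> carrier_mat m k. rank (?C' B) = rank ?C + r}.
        mat_of_cols m (map (\<lambda>v. vec_last v m) (map ?emb (cols B))) = B"
    proof safe
      fix B :: "'a mat" assume B: "B \<in> carrier_mat m k"
      have "map (\<lambda>v. vec_last v m) (map ?emb (cols B)) = cols B"
        using last cols_dim[of B] B unfolding map_map by (intro map_idI) auto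
      then show "mat_of_cols m (map (\<lambda>v. vec_last v m) (map ?emb (cols B))) = B"
        using mat_of_cols_cols[of B] B by simp
    qed
    have inv: "map ?emb (cols (mat_of_cols m (map (\<lambda>v. vec_last v m) bs))) = bs" if "set bs \<subseteq> E" for bs
    proof -
      have "map ?emb (map (\<lambda>v. vec_last v m) bs) = bs"
        using that last unfolding map_map by (intro map_idI) (auto simp: E_def subset_iff)
      moreover have "cols (mat_of_cols m (map (\<lambda>v. vec_last v m) bs)) = map (\<lambda>v. vec_last v m) bs"
        by (intro cols_mat_of_cols) auto
      ultimately show ?thesis by simp
    qed
    then show "\<forall>bs\<in>?X. map ?emb (cols (mat_of_cols m (map (\<lambda>v. vec_last v m) bs))) = bs"
      by simp
    show "(\<lambda>B. map ?emb (cols B)) ` {B \<in> carrier_mat m k. rank (?C' B) = rank ?C + r} \<subseteq> ?X"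
    proof safe
      fix B :: "'a mat" and x assume B: "B \<in> carrier_mat m k" and eq: "rank (?C' B) = rank ?C + r"
      show "length (map ?emb (cols B)) = k" using B by simp
      show "card (span (?S \<union> set (map ?emb (cols B)))) = ?q ^ r * card (span ?S)"
        using rank_iff[OF B] eq by simp
      assume "x \<in> set (map ?emb (cols B))"
      then show "x \<in> E" using cols_dim[of B] B by (auto simp: E_def)
    qed
    show "(\<lambda>bs. mat_of_cols m (map (\<lambda>v. vec_last v m) bs)) ` ?X \<subseteq> {B \<in> carrier_mat m k. rank (?C' B) = rank ?C + r}"
    proof (rule image_subsetI)
      fix bs assume bs: "bs \<in> ?X"
      let ?B = "mat_of_cols m (map (\<lambda>v. vec_last v m) bs)"
      have B: "?B \<in> carrier_mat m k" using bs by (intro carrier_matI) auto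
      have cols: "map ?emb (cols ?B) = bs" using bs by (intro inv) simp
      then show "?B \<in> {B \<in> carrier_mat m k. rank (?C' B) = rank ?C + r}"
        using rank_iff[OF B] B bs unfolding cols by blast
    qed
  qed
  then have "card {B \<in> carrier_mat m k. rank (?C' B) = rank ?C + r} = card ?X"
    by (rule bij_betw_same_card)
  then show ?thesis
    using card_spanning_extensions[OF refl prefix(4,5) S d', of k r] by simp
qed

section \<open>Growing the corners of a bidiagonal block matrix\<close>

lemma corner_split_rows:
  "corner n B (p + m) c = corner n B p c @\<^sub>r mat m c (\<lambda>(i, j). block_entry n B (p + i) j)"
  by (rule eq_matI) (auto simp: corner_def append_rows_def)

lemma corner_transpose_split_columns:
  "(corner n B r (p + m))\<^sup>T = (corner n B r p)\<^sup>T @\<^sub>r (mat r m (\<lambda>(i, j). block_entry n B i (p + j)))\<^sup>T"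
  by (rule eq_matI) (auto simp: corner_def append_rows_def)

lemma block_index:
  fixes k n x :: nat
  assumes "k * n \<le> x" "x < k * n + n"
  shows "x div n = k" "x mod n = x - k * n"
proof -
  show "x div n = k" using assms by (intro div_nat_eqI) (auto simp: mult.commute)
  then show "x mod n = x - k * n" by (simp flip: minus_div_mult_eq_mod)
qed

lemma corner_add_diagonal_block:
  assumes "1 \<le> n" and off: "\<And>i j. 1 \<le> i \<Longrightarrow> 1 \<le> j \<Longrightarrow> (i, j) \<notin> bidiagonal_positions \<Longrightarrow> B i j = 0\<^sub>m n n"
    and D: "B (Suc k) (Suc k) \<in> carrier_mat n n"
  shows "corner n B (k * n + n) (k * n + n) = four_block_mat (corner n B (k * n) (k * n)) (0\<^sub>m (k * n) n)
    (mat n (k * n) (\<lambda>(i, j). block_entry n B (k * n + i) j)) (B (Suc k) (Suc k))"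
proof (rule eq_matI)
  let ?F = "four_block_mat (corner n B (k * n) (k * n)) (0\<^sub>m (k * n) n)
    (mat n (k * n) (\<lambda>(i, j). block_entry n B (k * n + i) j)) (B (Suc k) (Suc k))"
  fix i j assume "i < dim_row ?F" "j < dim_col ?F"
  then have ij: "i < k * n + n" "j < k * n + n" using D by (auto simp: corner_def)
  note last = block_index[of k n]
  have "block_entry n B i j = 0" if "i < k * n" "k * n \<le> j"
  proof -
    have "i div n < k" using that(1) assms(1) by (simp add: less_mult_imp_div_less)
    then have "B (i div n + 1) (Suc k) = 0\<^sub>m n n" by (intro off) (auto simp: bidiagonal_positions_def)
    then show ?thesis using last[of j] that ij assms(1) by (simp add: block_entry_def)
  qed
  then show "corner n B (k * n + n) (k * n + n) $$ (i, j) = ?F $$ (i, j)"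
    using ij D last[of i] last[of j] by (auto simp: corner_def block_entry_def)
qed (use D in \<open>auto simp: corner_def\<close>)

lemma corner_add_subdiagonal_block:
  assumes "1 \<le> n" and off: "\<And>i j. 1 \<le> i \<Longrightarrow> 1 \<le> j \<Longrightarrow> (i, j) \<notin> bidiagonal_positions \<Longrightarrow> B i j = 0\<^sub>m n n"
    and D: "B (Suc (Suc k)) (Suc k) \<in> carrier_mat n n"
  shows "corner n B (Suc k * n + n) (k * n + n) = four_block_mat (corner n B (Suc k * n) (k * n))
    (mat (Suc k * n) n (\<lambda>(i, j). block_entry n B i (k * n + j))) (0\<^sub>m n (k * n)) (B (Suc (Suc k)) (Suc k))"
proof (rule eq_matI)
  let ?F = "four_block_mat (corner n B (Suc k * n) (k * n))
    (mat (Suc k * n) n (\<lambda>(i, j). block_entry n B i (k * n + j))) (0\<^sub>m n (k * n)) (B (Suc (Suc k)) (Suc k))"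
  fix i j assume "i < dim_row ?F" "j < dim_col ?F"
  then have ij: "i < Suc k * n + n" "j < k * n + n" using D by (auto simp: corner_def)
  note last = block_index[of _ n]
  have "block_entry n B i j = 0" if "Suc k * n \<le> i" "j < k * n"
  proof -
    have "j div n < k" using that(2) assms(1) by (simp add: less_mult_imp_div_less)
    then have "B (Suc (Suc k)) (j div n + 1) = 0\<^sub>m n n" by (intro off) (auto simp: bidiagonal_positions_def)
    then show ?thesis using last[of "Suc k" i] that ij assms(1) by (simp add: block_entry_def)
  qed
  then show "corner n B (Suc k * n + n) (k * n + n) $$ (i, j) = ?F $$ (i, j)"
    using ij D last[of "Suc k" i] last[of k j] by (auto simp: corner_def block_entry_def)
qed (use D in \<open>auto simp: corner_def\<close>)

text \<open>One formula for both parities of \<open>t\<close>. It also covers \<open>t = 0\<close>, where the corner has no columns.\<close>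

lemma C_rank_eq_rank_corner:
  "C_rank n B t = vec_space.rank ((t div 2 + 1) * n) (corner n B ((t div 2 + 1) * n) ((t + 1) div 2 * n))"
proof (cases "t = 0")
  case True
  interpret vec_space "TYPE('a)" n .
  have "rank (corner n B n 0) \<le> 0" by (rule rank_le_nc) (auto simp: corner_def)
  then show ?thesis using True by (simp add: C_rank_def)
next
  case False
  have "C_mat n B t = corner n B ((t div 2 + 1) * n) ((t + 1) div 2 * n)"
    by (cases "odd t") (auto simp: C_mat_def Let_def elim!: oddE evenE)
  then show ?thesis using False by (simp add: C_rank_def corner_def)
qed

text \<open>The nonzero blocks are numbered in the order in which they enter the corners: \<open>(1,1)\<close>, \<open>(2,1)\<close>,
\<open>(2,2)\<close>, \<open>(3,2)\<close> and so on, so that block \<open>(i, j)\<close> is number \<open>i + j - 1\<close> and the corner \<open>t\<close> consists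
of the blocks \<open>1, \<dots>, t\<close>.\<close>

definition staircase :: "nat \<Rightarrow> (nat \<Rightarrow> 'a::zero mat) \<Rightarrow> nat \<Rightarrow> nat \<Rightarrow> 'a mat" where
  "staircase n b i j = (if (i, j) \<in> bidiagonal_positions then b (i + j - 1) else 0\<^sub>m n n)"

lemma C_rank_cong:
  assumes "1 \<le> n"
    and "\<And>i j. 1 \<le> i \<Longrightarrow> i \<le> t div 2 + 1 \<Longrightarrow> 1 \<le> j \<Longrightarrow> j \<le> (t + 1) div 2 \<Longrightarrow> B i j = B' i j"
  shows "C_rank n B t = C_rank n B' t"
proof -
  have "block_entry n B i j = block_entry n B' i j" if "i < (t div 2 + 1) * n" "j < (t + 1) div 2 * n" for i j
  proof -
    have "i div n < t div 2 + 1" "j div n < (t + 1) div 2"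
      using that by (simp_all add: less_mult_imp_div_less)
    then show ?thesis unfolding block_entry_def by (subst assms(2)) auto
  qed
  then show ?thesis unfolding C_rank_eq_rank_corner corner_def by (intro arg_cong[where f = "vec_space.rank _"] eq_matI) auto
qed

lemma C_rank_staircase_cong:
  assumes "1 \<le> n" "\<And>s. 1 \<le> s \<Longrightarrow> s \<le> t \<Longrightarrow> b s = b' s"
  shows "C_rank n (staircase n b) t = C_rank n (staircase n b') t"
  using assms(1) by (rule C_rank_cong) (auto simp: staircase_def intro!: assms(2))

text \<open>Both kinds of growth brought into the shape of \<open>card_block_completions\<close>. For even \<open>t\<close>, the corner
\<open>t\<close> arises from the corner \<open>t - 1\<close> by appending rows, and the next block appends columns. For odd
\<open>t\<close> rows and columns are exchanged, and the transposed matrices are used.\<close>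

lemma next_block_completes:
  fixes b :: "nat \<Rightarrow> 'a::{field,finite} mat"
  assumes n: "1 \<le> n"
  obtains p c C1 C2 \<sigma> where "C1 \<in> carrier_mat p c" "C2 \<in> carrier_mat n c"
    "C_rank n (staircase n b) (t - 1) = vec_space.rank p C1"
    "C_rank n (staircase n b) t = vec_space.rank (p + n) (C1 @\<^sub>r C2)"
    "\<sigma> = id \<or> \<sigma> = transpose_mat"
    "\<And>D. D \<in> carrier_mat n n \<Longrightarrow> C_rank n (staircase n (b(Suc t := D))) (Suc t) =
      vec_space.rank (p + n) (four_block_mat C1 (0\<^sub>m p n) C2 (\<sigma> D))"
proof (cases "even t")
  case True
  then obtain k where t: "t = 2 * k" by (rule evenE)
  let ?B = "staircase n b"
  let ?C1 = "corner n ?B (k * n) (k * n)" and ?C2 = "mat n (k * n) (\<lambda>(i, j). block_entry n ?B (k * n + i) j)"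
  \<comment> \<open>For \<open>t = 0\<close>, truncated subtraction makes the previous corner the empty one; both sides are 0.\<close>
  have prev: "C_rank n ?B (t - 1) = vec_space.rank (k * n) ?C1"
  proof (cases k)
    case 0
    interpret vec_space "TYPE('a)" 0 .
    have "rank (corner n ?B 0 0) \<le> 0" by (rule rank_le_nc) (auto simp: corner_def)
    then show ?thesis using 0 t by (simp add: C_rank_def)
  qed (use t in \<open>simp add: C_rank_eq_rank_corner\<close>)
  have cur: "C_rank n ?B t = vec_space.rank (k * n + n) (?C1 @\<^sub>r ?C2)"
    unfolding C_rank_eq_rank_corner corner_split_rows[symmetric] by (simp add: t add.commute)
  have nxt: "C_rank n (staircase n (b(Suc t := D))) (Suc t) =
      vec_space.rank (k * n + n) (four_block_mat ?C1 (0\<^sub>m (k * n) n) ?C2 (id D))" if D: "D \<in> carrier_mat n n" for D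
  proof -
    let ?B' = "staircase n (b(Suc t := D))"
    have D': "?B' (Suc k) (Suc k) = D" by (simp add: staircase_def bidiagonal_positions_def t)
    have same: "block_entry n ?B' i j = block_entry n ?B i j" if "i < k * n + n" "j < k * n" for i j
    proof -
      have "i div n < Suc k" "j div n < k" using that by (simp_all add: less_mult_imp_div_less)
      then show ?thesis by (simp add: block_entry_def staircase_def t)
    qed
    have "corner n ?B' (k * n + n) (k * n + n) = four_block_mat (corner n ?B' (k * n) (k * n)) (0\<^sub>m (k * n) n)
        (mat n (k * n) (\<lambda>(i, j). block_entry n ?B' (k * n + i) j)) (?B' (Suc k) (Suc k))"
      using n D D' by (intro corner_add_diagonal_block) (auto simp: staircase_def)
    also have "corner n ?B' (k * n) (k * n) = ?C1"
      using same by (auto simp: corner_def intro!: eq_matI)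
    also have "mat n (k * n) (\<lambda>(i, j). block_entry n ?B' (k * n + i) j) = ?C2"
      using same by (auto intro!: eq_matI)
    finally show ?thesis
      unfolding D' C_rank_eq_rank_corner by (simp add: t add.commute fun_upd_def)
  qed
  show thesis
    by (rule that[OF _ _ prev cur _ nxt]) (auto simp: corner_def)
next
  case False
  then obtain k where t: "t = 2 * k + 1" by (rule oddE)
  let ?B = "staircase n b"
  let ?X1 = "corner n ?B (Suc k * n) (k * n)" and ?X2 = "mat (Suc k * n) n (\<lambda>(i, j). block_entry n ?B i (k * n + j))"
  have X: "?X1 \<in> carrier_mat (Suc k * n) (k * n)" "?X2 \<in> carrier_mat (Suc k * n) n" by (auto simp: corner_def)
  have prev: "C_rank n ?B (t - 1) = vec_space.rank (k * n) ?X1\<^sup>T"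
    unfolding rank_transpose[OF X(1)] C_rank_eq_rank_corner by (simp add: t)
  have cur: "C_rank n ?B t = vec_space.rank (k * n + n) (?X1\<^sup>T @\<^sub>r ?X2\<^sup>T)"
    unfolding corner_transpose_split_columns[symmetric]
    by (subst rank_transpose[of _ "Suc k * n"]) (auto simp: corner_def C_rank_eq_rank_corner t add.commute)
  have nxt: "C_rank n (staircase n (b(Suc t := D))) (Suc t) =
      vec_space.rank (k * n + n) (four_block_mat ?X1\<^sup>T (0\<^sub>m (k * n) n) ?X2\<^sup>T D\<^sup>T)" if D: "D \<in> carrier_mat n n" for D
  proof -
    let ?B' = "staircase n (b(Suc t := D))"
    have D': "?B' (Suc (Suc k)) (Suc k) = D" by (simp add: staircase_def bidiagonal_positions_def t)
    have same: "block_entry n ?B' i j = block_entry n ?B i j" if "i < Suc k * n" "j < k * n + n" for i j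
    proof -
      have "i div n < Suc k" "j div n < Suc k" using that by (simp_all add: less_mult_imp_div_less)
      then show ?thesis by (simp add: block_entry_def staircase_def t)
    qed
    have "corner n ?B' (Suc k * n + n) (k * n + n) = four_block_mat (corner n ?B' (Suc k * n) (k * n))
        (mat (Suc k * n) n (\<lambda>(i, j). block_entry n ?B' i (k * n + j))) (0\<^sub>m n (k * n)) (?B' (Suc (Suc k)) (Suc k))"
      using n D D' by (intro corner_add_subdiagonal_block) (auto simp: staircase_def)
    also have "corner n ?B' (Suc k * n) (k * n) = ?X1"
      using same by (auto simp: corner_def intro!: eq_matI)
    also have "mat (Suc k * n) n (\<lambda>(i, j). block_entry n ?B' i (k * n + j)) = ?X2"
      using same by (auto intro!: eq_matI)
    finally have "(corner n ?B' (Suc k * n + n) (k * n + n))\<^sup>T =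
        four_block_mat ?X1\<^sup>T (0\<^sub>m (k * n) n) ?X2\<^sup>T D\<^sup>T"
      unfolding D' by (simp only: transpose_four_block_mat[OF X zero_carrier_mat D] zero_transpose_mat)
    moreover have "C_rank n ?B' (Suc t) = vec_space.rank (Suc k * n + n) (corner n ?B' (Suc k * n + n) (k * n + n))"
      by (simp add: C_rank_eq_rank_corner t add.commute)
    ultimately show ?thesis
      using rank_transpose[of "corner n ?B' (Suc k * n + n) (k * n + n)" "Suc k * n + n" "k * n + n"]
      by (simp add: corner_def)
  qed
  show thesis
    by (rule that[OF _ _ prev cur _ nxt]) (auto simp: corner_def)
qed

text \<open>For \<open>t = 0\<close> the two ranks are the same, and the increment is 0.\<close>

definition increment :: "nat \<Rightarrow> (nat \<Rightarrow> 'a::field mat) \<Rightarrow> nat \<Rightarrow> nat" where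
  "increment n b t = C_rank n (staircase n b) t - C_rank n (staircase n b) (t - 1)"

lemma increment_cong:
  assumes "1 \<le> n" "\<And>s. 1 \<le> s \<Longrightarrow> s \<le> t \<Longrightarrow> b s = b' s"
  shows "increment n b t = increment n b' t"
  unfolding increment_def
  by (intro arg_cong2[where f = "(-)"] C_rank_staircase_cong assms(1)) (rule assms(2); simp)+

lemma C_rank_staircase_step:
  fixes b :: "nat \<Rightarrow> 'a::{field,finite} mat"
  assumes "1 \<le> n"
  shows "C_rank n (staircase n b) t = C_rank n (staircase n b) (t - 1) + increment n b t" "increment n b t \<le> n"
proof -
  obtain p c and C1 C2 :: "'a mat" where C: "C1 \<in> carrier_mat p c" "C2 \<in> carrier_mat n c"
    "C_rank n (staircase n b) (t - 1) = vec_space.rank p C1"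
    "C_rank n (staircase n b) t = vec_space.rank (p + n) (C1 @\<^sub>r C2)"
    by (rule next_block_completes[OF assms, of b t]) (erule (3) that)
  show "C_rank n (staircase n b) t = C_rank n (staircase n b) (t - 1) + increment n b t" "increment n b t \<le> n"
    unfolding increment_def C(3,4) using append_rows_rank(1,2)[OF C(1,2)] by linarith+
qed

text \<open>The deterministic core of the Markov property: whatever the first \<open>t\<close> blocks are, the number of
choices for the next block that lead to the increment \<open>r\<close> depends only on the current increment.\<close>

lemma card_next_block_increment:
  fixes b :: "nat \<Rightarrow> 'a::{field,finite} mat"
  assumes n: "1 \<le> n"
  shows "real (card {D \<in> carrier_mat n n. increment n (b(Suc t := D)) (Suc t) = r}) =
    real CARD('a) ^ (increment n b t * n) * rank_count (real CARD('a)) (n - increment n b t) n r"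
proof -
  obtain p c C1 C2 \<sigma> where C: "C1 \<in> carrier_mat p c" "C2 \<in> carrier_mat n c"
    and prev: "C_rank n (staircase n b) (t - 1) = vec_space.rank p C1"
    and cur: "C_rank n (staircase n b) t = vec_space.rank (p + n) (C1 @\<^sub>r C2)"
    and \<sigma>: "\<sigma> = id \<or> \<sigma> = (transpose_mat :: 'a mat \<Rightarrow> 'a mat)"
    and nxt: "\<And>D. D \<in> carrier_mat n n \<Longrightarrow> C_rank n (staircase n (b(Suc t := D))) (Suc t) =
      vec_space.rank (p + n) (four_block_mat C1 (0\<^sub>m p n) C2 (\<sigma> D))"
    by (rule next_block_completes[OF n, of b t]) (rule that)
  let ?P = "\<lambda>D. vec_space.rank (p + n) (four_block_mat C1 (0\<^sub>m p n) C2 D) = vec_space.rank (p + n) (C1 @\<^sub>r C2) + r"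
  have "increment n (b(Suc t := D)) (Suc t) = r \<longleftrightarrow> ?P (\<sigma> D)" if "D \<in> carrier_mat n n" for D
  proof -
    have "C_rank n (staircase n (b(Suc t := D))) t = C_rank n (staircase n b) t"
      using n by (rule C_rank_staircase_cong) auto
    then show ?thesis
      using C_rank_staircase_step(1)[OF n, of "b(Suc t := D)" "Suc t"] cur nxt[OF that] by auto
  qed
  then have "{D \<in> carrier_mat n n. increment n (b(Suc t := D)) (Suc t) = r} = {D \<in> carrier_mat n n. ?P (\<sigma> D)}"
    by blast
  moreover have "bij_betw \<sigma> {D \<in> carrier_mat n n. ?P (\<sigma> D)} {D \<in> carrier_mat n n. ?P D}"
    using \<sigma> by (intro bij_betw_byWitness[of _ \<sigma>]) auto
  ultimately have "card {D \<in> carrier_mat n n. increment n (b(Suc t := D)) (Suc t) = r} = card {D \<in> carrier_mat n n. ?P D}"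
    by (simp add: bij_betw_same_card)
  moreover have "vec_space.rank (p + n) (C1 @\<^sub>r C2) = vec_space.rank p C1 + increment n b t"
    using C_rank_staircase_step(1)[OF n, of b t] prev cur by simp
  ultimately show ?thesis using card_block_completions[OF C, of "increment n b t" n r] by simp
qed

section \<open>The random blocks\<close>

lemma card_carrier_mat: "card (carrier_mat m k :: 'a::finite mat set) = CARD('a) ^ (m * k)"
proof -
  have "bij_betw cols (carrier_mat m k :: 'a mat set) {vs. set vs \<subseteq> carrier_vec m \<and> length vs = k}"
  proof (rule bij_betw_byWitness[of _ "mat_of_cols m"])
    show "\<forall>A\<in>carrier_mat m k. mat_of_cols m (cols A) = (A :: 'a mat)"
      using mat_of_cols_cols by blast
    show "cols ` (carrier_mat m k :: 'a mat set) \<subseteq> {vs. set vs \<subseteq> carrier_vec m \<and> length vs = k}"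
    proof safe
      fix A :: "'a mat" and v assume "A \<in> carrier_mat m k" "v \<in> set (cols A)"
      then show "v \<in> carrier_vec m" using cols_dim[of A] by auto
    qed simp
  qed (auto intro!: cols_mat_of_cols)
  then have "card (carrier_mat m k :: 'a mat set) = card {vs. set vs \<subseteq> (carrier_vec m :: 'a vec set) \<and> length vs = k}"
    by (rule bij_betw_same_card)
  also have "\<dots> = CARD('a) ^ (m * k)"
    by (simp add: card_lists_length_eq card_carrier_vec power_mult)
  finally show ?thesis .
qed

lemma finite_carrier_mat: "finite (carrier_mat m k :: 'a::finite mat set)"
  by (rule card_ge_0_finite) (simp add: card_carrier_mat)

text \<open>The inverse of the numbering \<open>(i, j) \<mapsto> i + j - 1\<close> of the blocks in \<open>staircase\<close>.\<close>

definition block_position :: "nat \<Rightarrow> nat \<times> nat" where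
  "block_position s = (s div 2 + 1, (s + 1) div 2)"

lemma block_position_bidiagonal: "1 \<le> s \<Longrightarrow> block_position s \<in> bidiagonal_positions"
  unfolding block_position_def bidiagonal_positions_def by auto

lemma block_position_inverse:
  assumes "(i, j) \<in> bidiagonal_positions"
  shows "block_position (i + j - 1) = (i, j)"
proof -
  obtain k where "j = Suc k" "i = Suc k \<or> i = Suc (Suc k)"
    using assms by (cases j) (auto simp: bidiagonal_positions_def)
  then show ?thesis by (auto simp: block_position_def)
qed

lemma inj_block_position: "inj_on block_position UNIV"
proof (rule inj_on_inverseI)
  show "fst (block_position s) + snd (block_position s) - 1 = s" for s
    unfolding block_position_def by simp
qed

lemma (in prob_space) indep_vars_reindex:
  assumes indep: "indep_vars (\<lambda>_. N) X I" and f: "inj_on f J" "f ` J \<subseteq> I"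
  shows "indep_vars (\<lambda>_. N) (\<lambda>j. X (f j)) J"
  unfolding indep_vars_def2
proof (intro conjI ballI indep_setsI)
  fix K A
  assume K: "K \<noteq> {}" "K \<subseteq> J" "finite K" and A: "\<forall>j\<in>K. A j \<in> {X (f j) -` B \<inter> space M |B. B \<in> sets N}"
  have inj: "inj_on f K" using f(1) K(2) by (rule inj_on_subset)
  have "indep_sets (\<lambda>i. {X i -` B \<inter> space M |B. B \<in> sets N}) I"
    using indep by (simp add: indep_vars_def2)
  moreover have "f ` K \<noteq> {}" "f ` K \<subseteq> I" "finite (f ` K)" using K f by auto
  moreover have "\<forall>i\<in>f ` K. A (inv_into K f i) \<in> {X i -` B \<inter> space M |B. B \<in> sets N}"
    using A by (simp add: inv_into_f_f[OF inj])
  ultimately have "prob (\<Inter>i\<in>f ` K. A (inv_into K f i)) = (\<Prod>i\<in>f ` K. prob (A (inv_into K f i)))"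
    by (intro indep_setsD) auto
  moreover have "(\<Inter>i\<in>f ` K. A (inv_into K f i)) = (\<Inter>j\<in>K. A j)"
    by (simp add: inv_into_f_f[OF inj])
  moreover have "(\<Prod>i\<in>f ` K. prob (A (inv_into K f i))) = (\<Prod>j\<in>K. prob (A j))"
    by (simp add: prod.reindex[OF inj] inv_into_f_f[OF inj])
  ultimately show "prob (\<Inter>j\<in>K. A j) = (\<Prod>j\<in>K. prob (A j))" by simp
qed (use indep f(2) in \<open>auto simp: indep_vars_def2 image_subset_iff intro: measurable_sets\<close>)

text \<open>Finitely many independent uniform variables are jointly uniform, so probabilities of events that
depend on them are obtained by counting.\<close>

lemma (in prob_space) prob_indep_uniform:
  fixes X :: "'i \<Rightarrow> 'a \<Rightarrow> 'b"
  assumes indep: "indep_vars (\<lambda>_. count_space B) X I" and J: "J \<subseteq> I" "finite J" and B: "finite B" "B \<noteq> {}"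
    and unif: "\<And>j. j \<in> J \<Longrightarrow> distr M (count_space B) (X j) = uniform_count_measure B"
  shows "{\<omega> \<in> space M. Q (\<lambda>j\<in>J. X j \<omega>)} \<in> events"
    and "prob {\<omega> \<in> space M. Q (\<lambda>j\<in>J. X j \<omega>)} = card {b \<in> J \<rightarrow>\<^sub>E B. Q b} / card B ^ card J"
proof -
  have rv: "X j \<in> measurable M (count_space B)" if "j \<in> J" for j
    using indep J that by (auto simp: indep_vars_def)
  have val: "X j \<omega> \<in> B" if "j \<in> J" "\<omega> \<in> space M" for j \<omega>
    using measurable_space[OF rv[OF that(1)] that(2)] by simp
  let ?E = "\<lambda>b. {\<omega> \<in> space M. (\<lambda>j\<in>J. X j \<omega>) = b}"
  have E: "?E b = space M \<inter> (\<Inter>j\<in>J. X j -` {b j} \<inter> space M)" if "b \<in> J \<rightarrow>\<^sub>E B" for b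
    using that by (auto simp: fun_eq_iff restrict_def PiE_def extensional_def)
  have meas: "X j -` {c} \<inter> space M \<in> events" if "j \<in> J" "c \<in> B" for j c
    using measurable_sets[OF rv[OF that(1)], of "{c}"] that(2) by simp
  have single: "prob (X j -` {c} \<inter> space M) = 1 / card B" if "j \<in> J" "c \<in> B" for j c
  proof -
    have "prob (X j -` {c} \<inter> space M) = measure (distr M (count_space B) (X j)) {c}"
      using rv[OF that(1)] that(2) by (simp add: measure_distr)
    then show ?thesis using unif[OF that(1)] that(2) B by (simp add: measure_uniform_count_measure)
  qed
  have prob_E: "?E b \<in> events" "prob (?E b) = 1 / card B ^ card J" if b: "b \<in> J \<rightarrow>\<^sub>E B" for b
  proof -
    have bj: "b j \<in> B" if "j \<in> J" for j using b that by auto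
    have empty: "?E b = space M" if "J = {}" using b that by (auto simp: restrict_def)
    show "?E b \<in> events"
    proof (cases "J = {}")
      case False
      then show ?thesis
        unfolding E[OF b] using meas bj J(2) by (intro sets.Int[OF sets.top] sets.finite_INT) auto
    qed (use empty in simp)
    show "prob (?E b) = 1 / card B ^ card J"
    proof (cases "J = {}")
      case True
      then show ?thesis using empty by (simp add: prob_space)
    next
      case False
      then have "?E b = (\<Inter>j\<in>J. X j -` {b j} \<inter> space M)" unfolding E[OF b] by auto
      also have "prob \<dots> = (\<Prod>j\<in>J. prob (X j -` {b j} \<inter> space M))"
        using bj by (intro indep_varsD[OF indep False J(2,1)]) auto
      also have "\<dots> = (\<Prod>j\<in>J. 1 / card B)" using single bj by (intro prod.cong) auto
      finally show ?thesis by (simp add: power_one_over)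
    qed
  qed
  have fin: "finite {b \<in> J \<rightarrow>\<^sub>E B. Q b}" using finite_PiE[OF J(2), of "\<lambda>_. B"] B by simp
  have split: "{\<omega> \<in> space M. Q (\<lambda>j\<in>J. X j \<omega>)} = (\<Union>b\<in>{b \<in> J \<rightarrow>\<^sub>E B. Q b}. ?E b)"
    using val by auto
  show "{\<omega> \<in> space M. Q (\<lambda>j\<in>J. X j \<omega>)} \<in> events"
    unfolding split using fin prob_E(1) by (intro sets.finite_UN) auto
  have "disjoint_family_on ?E {b \<in> J \<rightarrow>\<^sub>E B. Q b}"
    by (auto simp: disjoint_family_on_def)
  then have "prob {\<omega> \<in> space M. Q (\<lambda>j\<in>J. X j \<omega>)} = (\<Sum>b\<in>{b \<in> J \<rightarrow>\<^sub>E B. Q b}. prob (?E b))"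
    unfolding split using prob_E(1) fin by (intro finite_measure_finite_Union) auto
  also have "\<dots> = (\<Sum>b\<in>{b \<in> J \<rightarrow>\<^sub>E B. Q b}. 1 / card B ^ card J)"
    using prob_E(2) by (intro sum.cong) auto
  finally show "prob {\<omega> \<in> space M. Q (\<lambda>j\<in>J. X j \<omega>)} = card {b \<in> J \<rightarrow>\<^sub>E B. Q b} / card B ^ card J" by simp
qed

lemma card_PiE_Suc:
  assumes "finite B"
  shows "card {b \<in> {1..Suc t} \<rightarrow>\<^sub>E B. Q b} =
    (\<Sum>b\<in>{1..t} \<rightarrow>\<^sub>E B. card {y \<in> B. Q (b(Suc t := y))})"
proof -
  have I: "{1..Suc t} = insert (Suc t) {1..t}" by auto
  have "{b \<in> {1..Suc t} \<rightarrow>\<^sub>E B. Q b} =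
      (\<lambda>(b, y). b(Suc t := y)) ` (SIGMA b:{1..t} \<rightarrow>\<^sub>E B. {y \<in> B. Q (b(Suc t := y))})"
    unfolding I PiE_insert_eq by (auto simp: image_iff)
  moreover have "inj_on (\<lambda>(b, y). b(Suc t := y)) (SIGMA b:{1..t} \<rightarrow>\<^sub>E B. {y \<in> B. Q (b(Suc t := y))})"
  proof (rule inj_onI, clarify)
    fix b y b' y' assume b: "b \<in> {1..t} \<rightarrow>\<^sub>E B" "b' \<in> {1..t} \<rightarrow>\<^sub>E B" and eq: "b(Suc t := y) = b'(Suc t := y')"
    have "b s = b' s" for s
      using fun_cong[OF eq, of s] b by (cases "s = Suc t") (auto simp: PiE_def extensional_def)
    then show "b = b' \<and> y = y'" using fun_cong[OF eq, of "Suc t"] by auto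
  qed
  ultimately have "card {b \<in> {1..Suc t} \<rightarrow>\<^sub>E B. Q b} =
      card (SIGMA b:{1..t} \<rightarrow>\<^sub>E B. {y \<in> B. Q (b(Suc t := y))})"
    by (simp add: card_image)
  then show ?thesis
    using assms finite_PiE[of "{1..t}" "\<lambda>_. B"] by simp
qed

lemma rank_increment_eq_increment:
  fixes A :: "nat \<Rightarrow> nat \<Rightarrow> 'w \<Rightarrow> 'a::{field,finite} mat"
  assumes n: "1 \<le> n" and A: "uniform_block_bidiagonal M n A" and \<omega>: "\<omega> \<in> space M" and "i \<le> t"
  shows "rank_increment n A i \<omega> = int (increment n (\<lambda>s\<in>{1..t}. case_prod A (block_position s) \<omega>) i)"
proof -
  let ?b = "\<lambda>s\<in>{1..t}. case_prod A (block_position s) \<omega>"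
  have "C_rank n (\<lambda>k l. A k l \<omega>) i = C_rank n (staircase n ?b) i" if "i \<le> t" for i
    using n
  proof (rule C_rank_cong)
    fix k l assume kl: "1 \<le> k" "k \<le> i div 2 + 1" "1 \<le> l" "l \<le> (i + 1) div 2"
    show "A k l \<omega> = staircase n ?b k l"
    proof (cases "(k, l) \<in> bidiagonal_positions")
      case True
      moreover have "k + l - 1 \<in> {1..t}" using kl that by auto
      ultimately show ?thesis using block_position_inverse[OF True] by (simp add: staircase_def)
    next
      case False
      then show ?thesis using A kl \<omega> by (auto simp: staircase_def uniform_block_bidiagonal_def)
    qed
  qed
  then have "C_rank n (\<lambda>k l. A k l \<omega>) i = C_rank n (staircase n ?b) i"
    "C_rank n (\<lambda>k l. A k l \<omega>) (i - 1) = C_rank n (staircase n ?b) (i - 1)"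
    using \<open>i \<le> t\<close> by auto
  then show ?thesis
    using C_rank_staircase_step(1)[OF n, of ?b i] by (auto simp: rank_increment_def increment_def)
qed

text \<open>The history up to time \<open>t\<close> is determined by the first \<open>t\<close> blocks, and by
\<open>card_next_block_increment\<close> each block sequence with that history has the same number \<open>c\<close> of
extensions that lead to \<open>x (Suc t)\<close>. Hence the conditional probability is \<open>c\<close> divided by the number of
all blocks.\<close>

lemma markov_chain_rank_increment:
  fixes A :: "nat \<Rightarrow> nat \<Rightarrow> 'w \<Rightarrow> 'a::{field,finite} mat"
  assumes n: "1 \<le> n" and A: "uniform_block_bidiagonal M n A"
  shows "markov_chain M (rank_increment n A) {0..int n} (rank_transition (real CARD('a)) n)"
proof -
  interpret prob_space M using A by (simp add: uniform_block_bidiagonal_def)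
  let ?q = "real CARD('a)" and ?B = "carrier_mat n n :: 'a mat set"
  have q: "1 < ?q" using one_less_card_field[where 'a='a] by simp
  define D where "D s \<omega> = case_prod A (block_position s) \<omega>" for s \<omega>
  have B: "finite ?B" "?B \<noteq> {}" using finite_carrier_mat zero_carrier_mat by blast+
  have indepD: "indep_vars (\<lambda>_. count_space ?B) D {1..}"
  proof -
    have "indep_vars (\<lambda>_. count_space ?B) (\<lambda>(i, j). A i j) bidiagonal_positions"
      using A by (simp add: uniform_block_bidiagonal_def)
    then have "indep_vars (\<lambda>_. count_space ?B) (\<lambda>s. case_prod A (block_position s)) {1..}"
      by (rule indep_vars_reindex) (use block_position_bidiagonal inj_on_subset[OF inj_block_position] in auto)
    then show ?thesis by (simp add: D_def[abs_def])
  qed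
  have unifD: "distr M (count_space ?B) (D s) = uniform_count_measure ?B" if "1 \<le> s" for s
    using A block_position_bidiagonal[OF that]
    by (auto simp: uniform_block_bidiagonal_def D_def[abs_def] split: prod.splits)
  have prob_D: "prob {\<omega> \<in> space M. Q (\<lambda>s\<in>{1..t}. D s \<omega>)} = card {b \<in> {1..t} \<rightarrow>\<^sub>E ?B. Q b} / real (card ?B) ^ t" for Q t
    using prob_indep_uniform(2)[OF indepD _ _ B unifD, of "{1..t}" Q] by auto
  have X: "rank_increment n A i \<omega> = int (increment n (\<lambda>s\<in>{1..t}. D s \<omega>) i)" if "\<omega> \<in> space M" "i \<le> t" for i t \<omega>
    using rank_increment_eq_increment[OF n A that] by (simp add: D_def)
  have meas: "rank_increment n A t \<in> measurable M (count_space {0..int n})" for t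
  proof -
    have "rank_increment n A t -` {h} \<inter> space M =
        {\<omega> \<in> space M. int (increment n (\<lambda>s\<in>{1..t}. D s \<omega>) t) = h}" for h
      using X[OF _ order_refl] by auto
    then have "rank_increment n A t -` {h} \<inter> space M \<in> events" for h
      using prob_indep_uniform(1)[OF indepD _ _ B unifD, of "{1..t}" "\<lambda>b. int (increment n b t) = h"] by auto
    moreover have "rank_increment n A t \<in> space M \<rightarrow> {0..int n}"
      using X[OF _ order_refl] C_rank_staircase_step(2)[OF n] by auto
    ultimately show ?thesis by (simp add: measurable_count_space_eq2)
  qed
  have "\<P>(\<omega> in M. rank_increment n A (Suc t) \<omega> = x (Suc t) \<bar> \<forall>i\<le>t. rank_increment n A i \<omega> = x i) =
      rank_transition ?q n (x t) (x (Suc t))"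
    if x: "\<forall>i\<le>Suc t. x i \<in> {0..int n}" and pos: "\<P>(\<omega> in M. \<forall>i\<le>t. rank_increment n A i \<omega> = x i) > 0" for t x
  proof -
    define Q where "Q t b \<longleftrightarrow> (\<forall>i\<le>t. int (increment n b i) = x i)" for t and b :: "nat \<Rightarrow> 'a mat"
    define d r where "d = nat (x t)" and "r = nat (x (Suc t))"
    have dr: "x t = int d" "x (Suc t) = int r" "d \<le> n" "r \<le> n"
      using x by (auto simp: d_def r_def nat_le_iff)
    define c where "c = ?q ^ (d * n) * rank_count ?q (n - d) n r"
    have past: "{\<omega> \<in> space M. \<forall>i\<le>t. rank_increment n A i \<omega> = x i} =
        {\<omega> \<in> space M. Q t (\<lambda>s\<in>{1..t}. D s \<omega>)}" for t
      using X by (auto simp: Q_def)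
    \<comment> \<open>Only the last increment involves the new block \<open>y\<close>; the earlier conditions concern \<open>b\<close> alone.\<close>
    have extensions: "real (card {y \<in> ?B. Q (Suc t) (b(Suc t := y))}) = (if Q t b then c else 0)" for b
    proof -
      have same: "increment n (b(Suc t := y)) i = increment n b i" if "i \<le> t" for y i
        using n by (rule increment_cong) (use that in auto)
      have "Q (Suc t) (b(Suc t := y)) \<longleftrightarrow> Q t b \<and> increment n (b(Suc t := y)) (Suc t) = r" for y
        using same dr(2) by (auto simp: Q_def le_Suc_eq)
      then have "{y \<in> ?B. Q (Suc t) (b(Suc t := y))} =
          (if Q t b then {y \<in> ?B. increment n (b(Suc t := y)) (Suc t) = r} else {})"
        by auto
      moreover have "increment n b t = d" if "Q t b" using that dr(1) by (auto simp: Q_def)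
      ultimately show ?thesis
        using card_next_block_increment[OF n, of b t r] by (auto simp: c_def)
    qed
    have "real (card {b \<in> {1..Suc t} \<rightarrow>\<^sub>E ?B. Q (Suc t) b}) = (\<Sum>b\<in>{1..t} \<rightarrow>\<^sub>E ?B. if Q t b then c else 0)"
      unfolding card_PiE_Suc[OF B(1)] of_nat_sum extensions ..
    also have "\<dots> = c * real (card {b \<in> {1..t} \<rightarrow>\<^sub>E ?B. Q t b})"
      using finite_PiE[of "{1..t}" "\<lambda>_. ?B"] B(1) by (simp add: sum.If_cases Int_def)
    finally have "prob {\<omega> \<in> space M. Q (Suc t) (\<lambda>s\<in>{1..Suc t}. D s \<omega>)} =
        c / real (card ?B) * prob {\<omega> \<in> space M. Q t (\<lambda>s\<in>{1..t}. D s \<omega>)}"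
      unfolding prob_D by simp
    moreover have "{\<omega> \<in> space M. rank_increment n A (Suc t) \<omega> = x (Suc t) \<and> (\<forall>i\<le>t. rank_increment n A i \<omega> = x i)} =
        {\<omega> \<in> space M. Q (Suc t) (\<lambda>s\<in>{1..Suc t}. D s \<omega>)}"
      unfolding past[symmetric] by (auto simp: le_Suc_eq)
    ultimately have "\<P>(\<omega> in M. rank_increment n A (Suc t) \<omega> = x (Suc t) \<bar> \<forall>i\<le>t. rank_increment n A i \<omega> = x i) =
        c / real (card ?B)"
      using pos unfolding cond_prob_def past by simp
    also have "\<dots> = rank_count ?q (n - d) n r / ?q ^ ((n - d) * n)"
    proof -
      have "n * n = d * n + (n - d) * n" using dr(3) by (simp add: add_mult_distrib[symmetric])
      then show ?thesis using q by (simp add: c_def card_carrier_mat power_add)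
    qed
    also have "\<dots> = rank_transition ?q n (x t) (x (Suc t))"
      unfolding dr(1,2) using rank_transition_eq_rank_count[OF q dr(3,4)] by simp
    finally show ?thesis .
  qed
  then show ?thesis
    unfolding markov_chain_def using stochastic_rank_transition[OF q] meas prob_space_axioms by blast
qed

theorem lemma1:
  fixes M :: "'w measure"
    and A :: "nat \<Rightarrow> nat \<Rightarrow> 'w \<Rightarrow> 'a::{field,finite} mat"
    and n q :: nat
  assumes "q = CARD('a)"
    and "n \<ge> 1"
    and "uniform_block_bidiagonal M n A"
  shows "let S = {0..int n}; P = rank_transition (real q) n; \<pi> = rank_stationary (real q) n in
    markov_chain M (rank_increment n A) S P
    \<and> irreducible_chain S P \<and> aperiodic_chain S P \<and> reversible_chain S P
    \<and> stationary_measure S P \<pi>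
    \<and> (\<forall>\<mu>. stationary_measure S P \<mu> \<longrightarrow> (\<forall>h\<in>S. \<mu> h = \<pi> h))"
proof -
  define S P \<pi> where "S = {0..int n}" and "P = rank_transition (real q) n" and "\<pi> = rank_stationary (real q) n"
  have q: "1 < real q" using one_less_card_field[where 'a='a] assms(1) by simp
  have hub: "finite S" "stochastic_on S P" "0 \<in> S" "\<And>x. x \<in> S \<Longrightarrow> 0 < P x 0" "\<And>x. x \<in> S \<Longrightarrow> 0 < P 0 x"
    using stochastic_rank_transition[OF q] rank_transition_pos[OF q] by (auto simp: S_def P_def)
  have \<pi>: "distribution_on S \<pi>" "\<And>h. h \<in> S \<Longrightarrow> 0 < \<pi> h"
    using rank_stationary_distribution[OF q] by (auto simp: S_def \<pi>_def)
  have balance: "\<pi> x * P x y = \<pi> y * P y x" if "x \<in> S" "y \<in> S" for x y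
    using rank_weight_detailed_balance[of "real q" x y n] q that
    by (simp add: S_def P_def \<pi>_def rank_stationary_def)
  have "markov_chain M (rank_increment n A) S P"
    unfolding S_def P_def assms(1) by (rule markov_chain_rank_increment[OF assms(2,3)])
  moreover have "irreducible_chain S P" "aperiodic_chain S P"
    using irreducible_via_hub[OF hub] aperiodic_via_hub[OF hub] by auto
  moreover have "reversible_chain S P" unfolding reversible_chain_def using \<pi>(1) balance by blast
  moreover have "stationary_measure S P \<pi>" using stationary_if_reversible[OF hub(2) \<pi>(1) balance] .
  moreover have "\<mu> h = \<pi> h" if "stationary_measure S P \<mu>" "h \<in> S" for \<mu> h
    using stationary_unique_via_hub[OF hub \<pi>(2,1) balance that] .
  ultimately show ?thesis unfolding Let_def S_def P_def \<pi>_def by blast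
qed

end
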